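(* Let $A\in\mathbb{R}^{d\times d}$ be any fixed symmetric matrix, and let $\mathbf{U}$ be uniform on the Stiefel manifold $\mathrm{Stief}(d,r)$. Then for all $0\le t\le d/4$, $$\Pr\left[\left\|\mathbf{U}^\top A\mathbf{U}-\frac{\mathrm{tr}(A)}{d}\cdot I_r\right\|_{\mathrm{op}}>\frac{8\left(t^{1/2}\|A\|_{\mathrm{F}}+t\|A\|_{\mathrm{op}}\right)}{d\,(1-2\sqrt{t/d})}\right]\le 3e^{-t+2.2r}.$$
   Context: $\mathrm{Stief}(d,r)=\{V\in\mathbb{R}^{d\times r}:V^\top V=I_r\}$, with its rotation-invariant probability measure. $\|\cdot\|_{\mathrm{op}}$ and $\|\cdot\|_{\mathrm F}$ are the operator and Frobenius norms. At $t=d/4$ the threshold is read as $+\infty$ (the statement is vacuous there). *)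

theory Defs
  imports "HOL-Probability.Probability"
begin

text \<open>A \<open>d \<times> r\<close> real matrix has type \<^typ>\<open>real^'r^'d\<close>, with \<open>d = CARD('d)\<close> rows and \<open>r = CARD('r)\<close>
  columns.\<close>

definition stiefel :: "(real^'r^'d) set" where
  "stiefel = {V. transpose V ** V = mat 1}"

abbreviation stiefel_borel :: "(real^'r^'d) measure" where
  "stiefel_borel \<equiv> restrict_space borel stiefel"

text \<open>Rotation invariance is invariance under the left action of the full orthogonal group \<open>O(d)\<close>.
  This action is transitive for every \<open>r \<le> d\<close>, so it determines the probability measure uniquely
  (\<open>SO(d)\<close> would not do so for \<open>r = d\<close>). For \<open>r > d\<close> the Stiefel manifold is empty and carries
  no probability measure.\<close>

definition uniform_on_stiefel :: "(real^'r^'d) measure \<Rightarrow> bool" where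
  "uniform_on_stiefel \<mu> \<longleftrightarrow>
     prob_space \<mu> \<and> sets \<mu> = sets stiefel_borel \<and>
     (\<forall>Q::real^'d^'d. orthogonal_matrix Q \<longrightarrow> distr \<mu> stiefel_borel (\<lambda>V. Q ** V) = \<mu>)"

abbreviation op_norm :: "real^'n^'m \<Rightarrow> real" where
  "op_norm X \<equiv> onorm (\<lambda>x. X *v x)"

definition frobenius_norm :: "real^'n^'m \<Rightarrow> real" where
  "frobenius_norm X = sqrt (\<Sum>i\<in>UNIV. \<Sum>j\<in>UNIV. (X $ i $ j)\<^sup>2)"

lemma frobenius_norm_eq_norm: "frobenius_norm X = norm X"
  by (simp add: frobenius_norm_def norm_vec_def L2_set_def sum_nonneg)

text \<open>The denominator vanishes exactly at \<open>t = d/4\<close>, where the threshold is read as \<open>+\<infinity>\<close>;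
  division by zero in \<^typ>\<open>real\<close> would give \<open>0\<close> instead.\<close>

definition deviation_threshold :: "real^'d^'d \<Rightarrow> real \<Rightarrow> ereal" where
  "deviation_threshold A t =
     (if t = real CARD('d) / 4 then \<infinity>
      else ereal (8 * (sqrt t * frobenius_norm A + t * op_norm A) /
                  (real CARD('d) * (1 - 2 * sqrt (t / real CARD('d))))))"

end

theory Submission
  imports Defs
begin

text \<open>For a unit vector \<open>x\<close> the vector \<open>u = U x\<close> is uniform on the unit sphere, so it is distributed as
  \<open>g / |g|\<close> for a standard Gaussian vector \<open>g\<close>. After diagonalising \<open>A\<close>, the event
  \<open>u\<^sup>T A u - tr A / d > \<theta>\<close> becomes \<open>\<Sum>i. (\<alpha>\<^sub>i - tr A / d - \<theta>) g\<^sub>i\<^sup>2 > 0\<close>, whose probability a single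
  Chernoff bound in the manner of Laurent and Massart estimates by \<open>exp (- t)\<close>, the normalisation \<open>|g|\<close>
  being absorbed in the coefficients. A union bound over a \<open>1/4\<close>-net of the unit sphere of \<open>\<real>\<^sup>r\<close> with at
  most \<open>9\<^sup>r \<le> exp (2.2 r)\<close> points concludes, since the operator norm of a symmetric matrix is at most
  twice the maximum of its quadratic form on such a net.

  That \<open>u\<close> and \<open>g / |g|\<close> have the same law follows from Christensen's theorem: two measures for which
  all balls of equal radius centred in the support have equal mass coincide. The same theorem gives the
  invariance of Lebesgue measure under orthogonal maps.\<close>

section \<open>Measures determined by balls\<close>

text \<open>Tonelli for the function \<open>indicator F u\<close> times the indicator of
  \<open>dist u v < e\<close>. Since the distance is symmetric, the inner integral is the mass of a
  ball in either order of integration.\<close>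

lemma emeasure_ball_integral_swap:
  fixes \<mu> \<nu> :: "'a::euclidean_space measure"
  assumes "sigma_finite_measure \<mu>" "sigma_finite_measure \<nu>"
    and sm[measurable_cong]: "sets \<mu> = sets borel" and sn[measurable_cong]: "sets \<nu> = sets borel"
    and F[measurable]: "F \<in> sets borel"
  shows "(\<integral>\<^sup>+u. indicator F u * emeasure \<nu> (ball u e) \<partial>\<mu>) = (\<integral>\<^sup>+v. emeasure \<mu> (F \<inter> ball v e) \<partial>\<nu>)"
proof -
  interpret m: sigma_finite_measure \<mu> by fact
  interpret n: sigma_finite_measure \<nu> by fact
  interpret p: pair_sigma_finite \<mu> \<nu> ..
  have [measurable]: "ball u e \<in> sets \<nu>" "ball u e \<in> sets \<mu>" for u
    using sm sn by auto
  have "(\<integral>\<^sup>+u. indicator F u * emeasure \<nu> (ball u e) \<partial>\<mu>) =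
      (\<integral>\<^sup>+u. (\<integral>\<^sup>+v. indicator F u * (if dist u v < e then 1 else 0) \<partial>\<nu>) \<partial>\<mu>)"
  proof (rule nn_integral_cong)
    fix u
    have "emeasure \<nu> (ball u e) = (\<integral>\<^sup>+v. (if dist u v < e then 1 else 0) \<partial>\<nu>)"
    proof -
      have "(\<integral>\<^sup>+v. (if dist u v < e then 1 else 0) \<partial>\<nu>) = (\<integral>\<^sup>+v. indicator (ball u e) v \<partial>\<nu>)"
        by (intro nn_integral_cong) (simp add: indicator_def)
      then show ?thesis by simp
    qed
    then show "indicator F u * emeasure \<nu> (ball u e)
       = (\<integral>\<^sup>+v. indicator F u * (if dist u v < e then 1 else 0) \<partial>\<nu>)"
      by (simp add: nn_integral_cmult)
  qed
  also have "\<dots> = (\<integral>\<^sup>+v. (\<integral>\<^sup>+u. indicator F u * (if dist u v < e then 1 else 0) \<partial>\<mu>) \<partial>\<nu>)"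
    by (rule p.Fubini'[symmetric]) measurable
  also have "\<dots> = (\<integral>\<^sup>+v. emeasure \<mu> (F \<inter> ball v e) \<partial>\<nu>)"
  proof (rule nn_integral_cong)
    fix v
    have "F \<inter> ball v e \<in> sets \<mu>" using sm by auto
    then show "(\<integral>\<^sup>+u. indicator F u * (if dist u v < e then 1 else 0) \<partial>\<mu>) = emeasure \<mu> (F \<inter> ball v e)"
    proof -
      assume F: "F \<inter> ball v e \<in> sets \<mu>"
      have "(\<integral>\<^sup>+u. indicator F u * (if dist u v < e then 1 else 0) \<partial>\<mu>)
          = (\<integral>\<^sup>+u. indicator (F \<inter> ball v e) u \<partial>\<mu>)"
        by (intro nn_integral_cong) (auto simp: indicator_def dist_commute)
      then show ?thesis using F by simp
    qed
  qed
  finally show ?thesis .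
qed

lemma sigma_finite_measure_ball:
  fixes \<mu> :: "'a::euclidean_space measure"
  assumes "sets \<mu> = sets borel" "\<And>n::nat. emeasure \<mu> (ball 0 (real n)) \<noteq> \<infinity>"
  shows "sigma_finite_measure \<mu>"
proof
  have "x \<in> (\<Union>n. ball 0 (real n))" for x :: 'a
    using reals_Archimedean2[of "norm x"] by auto
  then have "(\<Union>n. ball (0::'a) (real n)) = UNIV" by blast
  moreover have "space \<mu> = UNIV" using assms(1) sets_eq_imp_space_eq by force
  ultimately show "\<exists>A. countable A \<and> A \<subseteq> sets \<mu> \<and> \<Union> A = space \<mu> \<and> (\<forall>a\<in>A. emeasure \<mu> a \<noteq> \<infinity>)"
    using assms by (intro exI[of _ "range (\<lambda>n. ball 0 (real n))"]) auto
qed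

text \<open>Christensen's argument: integrate the indicator of \<open>dist u v < e\<close> over the points \<open>u\<close> at distance
  at least \<open>e\<close> from the complement of \<open>G\<close>, in both orders, and let \<open>e \<rightarrow> 0\<close>.\<close>

lemma emeasure_open_le_of_balls:
  fixes \<mu> \<nu> :: "'a::euclidean_space measure"
  assumes sm: "sets \<mu> = sets borel" and sn: "sets \<nu> = sets borel"
    and fm: "\<And>n::nat. emeasure \<mu> (ball 0 (real n)) \<noteq> \<infinity>"
    and fn: "\<And>n::nat. emeasure \<nu> (ball 0 (real n)) \<noteq> \<infinity>"
    and AEm: "AE x in \<mu>. x \<in> S" and AEn: "AE x in \<nu>. x \<in> S"
    and cm: "\<And>x e. x \<in> S \<Longrightarrow> e > 0 \<Longrightarrow> emeasure \<mu> (ball x e) = c e"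
    and cn: "\<And>x e. x \<in> S \<Longrightarrow> e > 0 \<Longrightarrow> emeasure \<nu> (ball x e) = c e"
    and c0: "\<And>e. e > 0 \<Longrightarrow> c e \<noteq> 0" and ci: "\<And>e. e > 0 \<Longrightarrow> c e \<noteq> \<infinity>"
    and G: "open G"
  shows "emeasure \<mu> G \<le> emeasure \<nu> G"
proof -
  \<comment> \<open>The open set shrunk by a margin: these sets are closed, hence measurable, and
    increase to \<open>G\<close>, so an estimate with a fixed radius suffices for each of
    them.\<close>
  define H where "H n = {x. ball x (1 / real (Suc n)) \<subseteq> G}" for n
  have clH: "closed (H n)" for n
  proof -
    have "- H n = (\<Union>y\<in>-G. ball y (1 / real (Suc n)))"
      by (auto simp: H_def dist_commute)
    then show ?thesis unfolding closed_def by auto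
  qed
  have HG: "H n \<subseteq> G" for n by (auto simp: H_def)
  have incH: "incseq H"
  proof (rule incseq_SucI)
    fix n
    have "ball x (1 / real (Suc (Suc n))) \<subseteq> ball x (1 / real (Suc n))" for x :: 'a
      by (rule subset_ball) (simp add: frac_le)
    then show "H n \<le> H (Suc n)" unfolding H_def by blast
  qed
  have UH: "(\<Union>n. H n) = G"
  proof
    show "G \<subseteq> (\<Union>n. H n)"
    proof
      fix x assume "x \<in> G"
      then obtain e where e: "e > 0" "ball x e \<subseteq> G" using G open_contains_ball by blast
      obtain n where n: "1 / real (Suc n) < e" using e(1) nat_approx_posE by blast
      then have "ball x (1 / real (Suc n)) \<subseteq> G" using e(2) by force
      then show "x \<in> (\<Union>n. H n)" by (auto simp: H_def)
    qed
  qed (use HG in auto)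
  have le: "emeasure \<mu> (H n) \<le> emeasure \<nu> G" for n
  proof -
    define e where "e = 1 / real (Suc n)"
    have e: "e > 0" by (simp add: e_def)
    have bH: "H n \<in> sets borel" using clH[of n] by (rule borel_closed)
    have "c e * emeasure \<mu> (H n) = (\<integral>\<^sup>+u. indicator (H n) u * c e \<partial>\<mu>)"
      using bH sm nn_integral_cmult_indicator[of "H n" \<mu> "c e"] by (simp add: mult.commute)
    also have "\<dots> = (\<integral>\<^sup>+u. indicator (H n) u * emeasure \<nu> (ball u e) \<partial>\<mu>)"
      using AEm by (intro nn_integral_cong_AE) (auto simp: cn e)
    also have "\<dots> = (\<integral>\<^sup>+v. emeasure \<mu> (H n \<inter> ball v e) \<partial>\<nu>)"
      by (rule emeasure_ball_integral_swap)
        (use sm sn fm fn bH in \<open>auto intro: sigma_finite_measure_ball\<close>)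
    also have "\<dots> \<le> (\<integral>\<^sup>+v. c e * indicator G v \<partial>\<nu>)"
    proof (rule nn_integral_mono_AE)
      show "AE v in \<nu>. emeasure \<mu> (H n \<inter> ball v e) \<le> c e * indicator G v"
        using AEn
      proof eventually_elim
        fix v assume v: "v \<in> S"
        show "emeasure \<mu> (H n \<inter> ball v e) \<le> c e * indicator G v"
        proof (cases "v \<in> G")
          case True
          have "emeasure \<mu> (H n \<inter> ball v e) \<le> emeasure \<mu> (ball v e)"
            by (rule emeasure_mono) (auto simp: sm)
          with True v e show ?thesis by (simp add: cm)
        next
          \<comment> \<open>A point outside \<open>G\<close> has distance at least \<open>e\<close>
            from every point of \<open>H n\<close>.\<close>
          case False
          then have "H n \<inter> ball v e = {}" by (auto simp: H_def e_def dist_commute)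
          then show ?thesis by simp
        qed
      qed
    qed
    also have "\<dots> = c e * emeasure \<nu> G"
      using G sn by (subst nn_integral_cmult_indicator) auto
    finally have "c e * emeasure \<mu> (H n) \<le> c e * emeasure \<nu> G" .
    \<comment> \<open>In \<open>ennreal\<close> the common factor cancels only because it is neither
      0 nor infinite.\<close>
    then show ?thesis using c0[OF e] ci[OF e]
      by (simp add: ennreal_mult_le_mult_iff)
  qed
  have "emeasure \<mu> G = (SUP n. emeasure \<mu> (H n))"
    using clH sm incH by (subst UH[symmetric], intro SUP_emeasure_incseq[symmetric]) auto
  also have "\<dots> \<le> emeasure \<nu> G" using le by (intro SUP_least)
  finally show ?thesis .
qed

text \<open>The hypotheses are symmetric in the two measures, so the previous inequality holds both
  ways on open sets. These form an intersection-stable generator of the Borel sets, and the balls of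
  integer radius exhaust the space with finite mass.\<close>

lemma measure_eqI_balls:
  fixes \<mu> \<nu> :: "'a::euclidean_space measure"
  assumes sm: "sets \<mu> = sets borel" and sn: "sets \<nu> = sets borel"
    and fm: "\<And>n::nat. emeasure \<mu> (ball 0 (real n)) \<noteq> \<infinity>"
    and fn: "\<And>n::nat. emeasure \<nu> (ball 0 (real n)) \<noteq> \<infinity>"
    and AEm: "AE x in \<mu>. x \<in> S" and AEn: "AE x in \<nu>. x \<in> S"
    and cm: "\<And>x e. x \<in> S \<Longrightarrow> e > 0 \<Longrightarrow> emeasure \<mu> (ball x e) = c e"
    and cn: "\<And>x e. x \<in> S \<Longrightarrow> e > 0 \<Longrightarrow> emeasure \<nu> (ball x e) = c e"
    and c0: "\<And>e. e > 0 \<Longrightarrow> c e \<noteq> 0" and ci: "\<And>e. e > 0 \<Longrightarrow> c e \<noteq> \<infinity>"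
  shows "\<mu> = \<nu>"
proof (rule measure_eqI_generator_eq[where \<Omega>=UNIV and E="{G. open G}" and A="\<lambda>n. ball 0 (real n)"])
  show "Int_stable {G::'a set. open G}" by (auto simp: Int_stable_def)
  show "sets \<mu> = sigma_sets UNIV {G. open G}" "sets \<nu> = sigma_sets UNIV {G. open G}"
    using sm sn by (auto simp: borel_def)
  show "(\<Union>n. ball (0::'a) (real n)) = UNIV"
    using reals_Archimedean2 by (auto simp: set_eq_iff)
  show "emeasure \<mu> (ball 0 (real n)) \<noteq> \<infinity>" for n by (rule fm)
  fix G :: "'a set" assume "G \<in> {G. open G}"
  then have "open G" by simp
  then show "emeasure \<mu> G = emeasure \<nu> G"
    using emeasure_open_le_of_balls[OF sm sn fm fn AEm AEn cm cn c0 ci]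
      emeasure_open_le_of_balls[OF sn sm fn fm AEn AEm cn cm c0 ci]
    by (simp add: antisym)
qed auto

section \<open>Orthogonal invariance of Lebesgue measure and uniqueness of the invariant measure on
  the sphere\<close>

lemma orthogonal_transformation_vimage_ball:
  fixes T :: "'a::euclidean_space \<Rightarrow> 'a"
  assumes "orthogonal_transformation T"
  shows "T -` ball (T x) e = ball x e"
proof -
  have "dist (T x) (T y) = dist x y" for y
    by (metis assms dist_norm linear_diff orthogonal_transformation_linear orthogonal_transformation_norm)
  then show ?thesis by (simp add: vimage_def ball_def)
qed

lemma orthogonal_transformation_borel_measurable:
  fixes T :: "'a::euclidean_space \<Rightarrow> 'a"
  assumes "orthogonal_transformation T"
  shows "T \<in> borel_measurable borel"
proof (rule borel_measurable_continuous_onI)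
  have "bounded_linear T" using orthogonal_transformation_linear[OF assms] by (simp add: linear_linear)
  then show "continuous_on UNIV T" by (rule linear_continuous_on)
qed

text \<open>An isometry pulls balls back to balls of the same radius, whose Lebesgue measure does
  not depend on the centre. Hence the ball criterion applies with every point as an admissible
  centre.\<close>

lemma lborel_distr_orthogonal_transformation:
  fixes T :: "'a::euclidean_space \<Rightarrow> 'a"
  assumes T: "orthogonal_transformation T"
  shows "distr lborel borel T = lborel"
proof (rule measure_eqI_balls[where S=UNIV and c="\<lambda>e. emeasure lborel (ball (0::'a) e)"])
  note mT[measurable] = orthogonal_transformation_borel_measurable[OF T]
  have ball: "emeasure lborel (ball x e) = emeasure lborel (ball (0::'a) e)" for x :: 'a and e :: real
    by (cases "e > 0") (simp_all add: emeasure_ball ball_empty)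
  then show "emeasure lborel (ball x e) = emeasure lborel (ball (0::'a) e)" for x :: 'a and e :: real .
  have dball: "emeasure (distr lborel borel T) (ball x e) = emeasure lborel (ball (0::'a) e)" for x e
  proof -
    obtain y where y: "x = T y" using orthogonal_transformation_surj[OF T] by (metis surjD)
    have "emeasure (distr lborel borel T) (ball x e) = emeasure lborel (T -` ball x e)"
      by (simp add: emeasure_distr)
    also have "T -` ball x e = ball y e"
      unfolding y by (rule orthogonal_transformation_vimage_ball[OF T])
    also have "emeasure lborel (ball y e) = emeasure lborel (ball (0::'a) e)" by (rule ball)
    finally show ?thesis .
  qed
  then show "emeasure (distr lborel borel T) (ball x e) = emeasure lborel (ball (0::'a) e)" for x e .
  show "emeasure (distr lborel borel T) (ball 0 (real n)) \<noteq> \<infinity>" for n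
    unfolding dball by (rule order.strict_implies_not_eq[OF emeasure_lborel_ball_finite])
  show "emeasure lborel (ball (0::'a) (real n)) \<noteq> \<infinity>" for n
    by (rule order.strict_implies_not_eq[OF emeasure_lborel_ball_finite])
  show "emeasure lborel (ball (0::'a) e) \<noteq> \<infinity>" for e
    by (rule order.strict_implies_not_eq[OF emeasure_lborel_ball_finite])
  show "emeasure lborel (ball (0::'a) e) \<noteq> 0" if "e > 0" for e
    using that content_ball_gt_0_iff[of "0::'a" e] by (auto simp: measure_def)
qed auto

text \<open>The orthogonal group is transitive on the sphere, so each measure separately gives equal
  mass to balls of equal radius centred there. It remains to match the two constants and to show
  that they are positive.\<close>

lemma sphere_measure_unique:
  fixes \<mu> \<nu> :: "(real^'n) measure"
  assumes pm: "prob_space \<mu>" and pn: "prob_space \<nu>"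
    and sm: "sets \<mu> = sets borel" and sn: "sets \<nu> = sets borel"
    and AEm: "AE x in \<mu>. norm x = 1" and AEn: "AE x in \<nu>. norm x = 1"
    and Tm: "\<And>T. orthogonal_transformation T \<Longrightarrow> distr \<mu> borel T = \<mu>"
    and Tn: "\<And>T. orthogonal_transformation T \<Longrightarrow> distr \<nu> borel T = \<nu>"
  shows "\<mu> = \<nu>"
proof -
  interpret m: prob_space \<mu> by fact
  interpret n: prob_space \<nu> by fact
  define x0 :: "real^'n" where "x0 = axis undefined 1"
  have x0: "norm x0 = 1" by (simp add: x0_def)
  have inv: "emeasure \<rho> (ball x e) = emeasure \<rho> (ball x0 e)"
    if nx: "norm x = 1" and sr: "sets \<rho> = sets borel"
      and T: "\<And>T. orthogonal_transformation T \<Longrightarrow> distr \<rho> borel T = \<rho>"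
    for \<rho> :: "(real^'n) measure" and x e
  proof -
    obtain T where oT: "orthogonal_transformation T" and Tx: "T x = x0"
      by (metis orthogonal_transformation_exists nx x0)
    have "T \<in> measurable \<rho> borel"
      using orthogonal_transformation_borel_measurable[OF oT] sr by (simp cong: measurable_cong_sets)
    moreover have "space \<rho> = UNIV" using sr sets_eq_imp_space_eq by force
    ultimately have "emeasure (distr \<rho> borel T) (ball x0 e) = emeasure \<rho> (T -` ball x0 e)"
      by (subst emeasure_distr) auto
    with T[OF oT] Tx orthogonal_transformation_vimage_ball[OF oT, of x e] show ?thesis by simp
  qed
  define c where "c e = emeasure \<mu> (ball x0 e)" for e
  have cm: "emeasure \<mu> (ball x e) = c e" if "norm x = 1" for x e
    unfolding c_def using inv[OF that sm Tm] by simp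
  have cn: "emeasure \<nu> (ball x e) = c e" if "norm x = 1" for x e
  proof -
    have eq: "emeasure \<nu> (ball x e) = emeasure \<nu> (ball x0 e)" by (rule inv[OF that sn Tn])
    \<comment> \<open>Both constants equal the product mass of the pairs at distance less than
      \<open>e\<close>, computed in the two orders.\<close>
    have "emeasure \<nu> (ball x0 e) = (\<integral>\<^sup>+u. emeasure \<nu> (ball x0 e) \<partial>\<mu>)"
      by (simp add: m.emeasure_space_1)
    also have "\<dots> = (\<integral>\<^sup>+u. indicator UNIV u * emeasure \<nu> (ball u e) \<partial>\<mu>)"
      using AEm by (intro nn_integral_cong_AE) (auto simp: inv[OF _ sn Tn])
    also have "\<dots> = (\<integral>\<^sup>+v. emeasure \<mu> (UNIV \<inter> ball v e) \<partial>\<nu>)"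
      by (rule emeasure_ball_integral_swap)
        (use sm sn m.sigma_finite_measure_axioms n.sigma_finite_measure_axioms in auto)
    also have "\<dots> = (\<integral>\<^sup>+v. c e \<partial>\<nu>)"
      using AEn by (intro nn_integral_cong_AE) (auto simp: cm)
    also have "\<dots> = c e" by (simp add: n.emeasure_space_1)
    finally show ?thesis using eq by simp
  qed
  \<comment> \<open>By compactness finitely many balls of radius \<open>e\<close> cover the sphere;
    if all were null, the sphere would be null, although it carries the whole mass.\<close>
  have c0: "c e \<noteq> 0" if e: "e > 0" for e
  proof
    assume z: "c e = 0"
    have sub: "sphere (0::real^'n) 1 \<subseteq> (\<Union>x\<in>sphere 0 1. ball x e)" using e by auto
    obtain D where D: "D \<subseteq> sphere (0::real^'n) 1" "finite D" "sphere 0 1 \<subseteq> (\<Union>x\<in>D. ball x e)"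
      by (rule compactE_image[OF compact_sphere _ sub]) auto
    have "(\<Union>x\<in>D. ball x e) \<in> null_sets \<mu>"
      using D z sm by (intro null_sets_UN') (auto simp: cm null_sets_def countable_finite)
    then have "AE x in \<mu>. x \<notin> (\<Union>x\<in>D. ball x e)" by (rule AE_not_in)
    with AEm have "AE x in \<mu>. False"
    proof eventually_elim
      fix x :: "real^'n" assume "norm x = 1" "x \<notin> (\<Union>x\<in>D. ball x e)"
      then show False using D(3) by auto
    qed
    then show False by simp
  qed
  show ?thesis
    by (rule measure_eqI_balls[where S="{x. norm x = 1}" and c=c])
      (use sm sn AEm AEn cm cn c0 in \<open>auto simp: c_def\<close>)
qed

section \<open>Diagonalisation of symmetric matrices\<close>

text \<open>The first-order condition at an extremum, in algebraic form.\<close>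

lemma quadratic_nonneg_imp_linear_zero:
  fixes a b :: real
  assumes "\<And>s. 0 \<le> a * s + b * s\<^sup>2"
  shows "a = 0"
proof (rule ccontr)
  assume a: "a \<noteq> 0"
  \<comment> \<open>Any positive \<open>k\<close> above \<open>b\<close> would serve: at
    \<open>s = - a / k\<close> the quadratic takes the value
    \<open>a\<^sup>2 * (b - k) / k\<^sup>2\<close>, which is negative.\<close>
  define k where "k = \<bar>b\<bar> + 1"
  have k: "k > 0" "b < k" by (auto simp: k_def)
  have "a * (- a / k) + b * (- a / k)\<^sup>2 = a\<^sup>2 * (b - k) / k\<^sup>2"
    using k by (simp add: field_simps power2_eq_square)
  moreover have "a\<^sup>2 * (b - k) / k\<^sup>2 < 0"
    using a k by (simp add: divide_neg_pos mult_pos_neg)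
  ultimately show False using assms[of "- a / k"] by linarith
qed

text \<open>A maximiser of the Rayleigh quotient over the unit sphere of \<open>S\<close> exists by
  compactness, and the first-order condition makes it an eigenvector.\<close>

lemma self_adjoint_eigenvector:
  fixes f :: "'a::euclidean_space \<Rightarrow> 'a"
  assumes lin: "linear f" and sym: "\<And>x y. f x \<bullet> y = x \<bullet> f y"
    and S: "subspace S" and inv: "f ` S \<subseteq> S" and "dim S > 0"
  obtains v c where "v \<in> S" "norm v = 1" "f v = c *\<^sub>R v"
proof -
  obtain w where w: "w \<in> S" "w \<noteq> 0" using \<open>dim S > 0\<close> by (metis dim_eq_0 less_irrefl singletonI subsetI)
  have "w /\<^sub>R norm w \<in> S \<inter> sphere 0 1" using w S by (simp add: subspace_scale)
  moreover have "compact (S \<inter> sphere 0 1)" using S by (simp add: closed_Int_compact closed_subspace)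
  moreover have "continuous_on (S \<inter> sphere 0 1) (\<lambda>x. f x \<bullet> x)"
    using lin by (intro continuous_intros linear_continuous_on) (simp add: linear_linear)
  ultimately obtain v where v: "v \<in> S \<inter> sphere 0 1"
    and max: "\<And>x. x \<in> S \<inter> sphere 0 1 \<Longrightarrow> f x \<bullet> x \<le> f v \<bullet> v"
    using continuous_attains_sup[of "S \<inter> sphere 0 1" "\<lambda>x. f x \<bullet> x"] by blast
  define c where "c = f v \<bullet> v"
  have vv: "v \<bullet> v = 1" using v by (simp add: norm_eq_1)
  have bound: "f x \<bullet> x \<le> c * (x \<bullet> x)" if "x \<in> S" for x
  proof (cases "x = 0")
    case True
    then show ?thesis by simp
  next
    case False
    have "x /\<^sub>R norm x \<in> S \<inter> sphere 0 1" using that False S by (simp add: subspace_scale)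
    from max[OF this] have "f x \<bullet> x / (norm x)\<^sup>2 \<le> c"
      by (simp add: c_def linear_scale[OF lin] power2_eq_square divide_inverse mult_ac)
    then show ?thesis using False by (simp add: divide_le_eq dot_square_norm)
  qed
  \<comment> \<open>The residual of the eigenvalue equation serves as the direction of variation:
    along \<open>v + s *\<^sub>R w\<close> the linear coefficient is
    \<open>2 * (w \<bullet> w)\<close>, so its vanishing forces \<open>w = 0\<close>.\<close>
  define w where "w = c *\<^sub>R v - f v"
  have wS: "w \<in> S" using v inv S by (auto simp: w_def intro!: subspace_diff subspace_scale)
  have "0 \<le> 2 * (w \<bullet> w) * s + (c * (w \<bullet> w) - f w \<bullet> w) * s\<^sup>2" for s
  proof -
    have "v + s *\<^sub>R w \<in> S" using v wS S by (auto intro!: subspace_add subspace_scale)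
    from bound[OF this]
    have "0 \<le> c * ((v + s *\<^sub>R w) \<bullet> (v + s *\<^sub>R w)) - f (v + s *\<^sub>R w) \<bullet> (v + s *\<^sub>R w)" by simp
    also have "\<dots> = c * (v \<bullet> v) - f v \<bullet> v + 2 * (c * (v \<bullet> w) - f v \<bullet> w) * s + (c * (w \<bullet> w) - f w \<bullet> w) * s\<^sup>2"
      using sym[of w v]
      by (simp add: linear_add[OF lin] linear_scale[OF lin] inner_add_left inner_add_right
          inner_commute algebra_simps power2_eq_square)
    also have "c * (v \<bullet> v) - f v \<bullet> v = 0" by (simp add: c_def vv)
    also have "c * (v \<bullet> w) - f v \<bullet> w = w \<bullet> w" by (simp add: w_def inner_diff_left)
    finally show ?thesis by simp
  qed
  then have "2 * (w \<bullet> w) = 0" by (rule quadratic_nonneg_imp_linear_zero)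
  then have "f v = c *\<^sub>R v" by (simp add: w_def)
  with v show ?thesis by (intro that) auto
qed

text \<open>Induction on the dimension: split off one unit eigenvector and continue in its
  orthogonal complement within \<open>S\<close>.\<close>

lemma self_adjoint_eigenbasis:
  fixes f :: "'a::euclidean_space \<Rightarrow> 'a"
  assumes lin: "linear f" and sym: "\<And>x y. f x \<bullet> y = x \<bullet> f y"
    and "subspace S" and "f ` S \<subseteq> S"
  shows "\<exists>B\<subseteq>S. finite B \<and> card B = dim S \<and> pairwise orthogonal B \<and>
           (\<forall>b\<in>B. norm b = 1 \<and> (\<exists>c. f b = c *\<^sub>R b))"
  using assms(3,4)
proof (induction "dim S" arbitrary: S)
  case 0
  then show ?case by (intro exI[of _ "{}"]) auto
next
  case (Suc n)
  obtain v c where v: "v \<in> S" "norm v = 1" "f v = c *\<^sub>R v"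
    using self_adjoint_eigenvector[OF lin sym Suc.prems] Suc.hyps(2) by auto
  define S' where "S' = {y \<in> S. \<forall>x\<in>span {v}. orthogonal x y}"
  have "dim S' + dim (span {v}) = dim S"
    unfolding S'_def
    using v Suc.prems by (intro dim_subspace_orthogonal_to_vectors) (auto simp: span_minimal)
  moreover have "dim (span {v}) = 1" using v by (subst dim_span, subst dim_singleton) auto
  ultimately have dS': "dim S' = n" using Suc.hyps(2) by simp
  have S'_alt: "S' = {y \<in> S. v \<bullet> y = 0}"
    unfolding S'_def by (auto simp: orthogonal_def span_singleton)
  have subS': "subspace S'" using Suc.prems(1)
    by (auto simp: S'_alt subspace_def inner_add_right)
  \<comment> \<open>Self-adjointness moves \<open>f\<close> onto the eigenvector:
    \<open>v \<bullet> f y = f v \<bullet> y = c * (v \<bullet> y) = 0\<close>.\<close>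
  have invS': "f ` S' \<subseteq> S'"
    using Suc.prems(2) v by (auto simp: S'_alt sym[symmetric])
  obtain B where B: "B \<subseteq> S'" "finite B" "card B = n" "pairwise orthogonal B"
    "\<And>b. b \<in> B \<Longrightarrow> norm b = 1 \<and> (\<exists>c. f b = c *\<^sub>R b)"
    using Suc.hyps(1)[OF dS'[symmetric] subS' invS'] dS' by auto
  have vB: "v \<notin> B" using B(1) v by (auto simp: S'_alt)
  show ?case
  proof (intro exI[of _ "insert v B"] conjI)
    show "insert v B \<subseteq> S" using B v by (auto simp: S'_alt)
    show "card (insert v B) = dim S" using B vB Suc.hyps(2) by simp
    show "pairwise orthogonal (insert v B)"
      using B by (auto simp: pairwise_insert S'_alt orthogonal_def inner_commute)
    show "\<forall>b\<in>insert v B. norm b = 1 \<and> (\<exists>c. f b = c *\<^sub>R b)" using v B(5) by auto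
  qed (use B in auto)
qed

definition diag_mat :: "('n \<Rightarrow> real) \<Rightarrow> real^'n^'n" where
  "diag_mat a = (\<chi> i j. if i = j then a i else 0)"

lemma symmetric_matrix_diagonalization:
  fixes A :: "real^'n^'n"
  assumes "transpose A = A"
  obtains Q a where "orthogonal_matrix Q" "A = Q ** diag_mat a ** transpose Q"
proof -
  have "\<exists>B\<subseteq>UNIV. finite B \<and> card B = dim (UNIV :: (real^'n) set) \<and> pairwise orthogonal B \<and>
           (\<forall>b\<in>B. norm b = 1 \<and> (\<exists>c. A *v b = c *\<^sub>R b))"
  proof (rule self_adjoint_eigenbasis)
    show "(A *v x) \<bullet> y = x \<bullet> (A *v y)" for x y
      by (metis assms dot_lmul_matrix vector_transpose_matrix)
  qed auto
  then obtain B where B: "finite B" "card B = CARD('n)" "pairwise orthogonal B"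
    "\<And>b. b \<in> B \<Longrightarrow> norm b = 1 \<and> (\<exists>c. A *v b = c *\<^sub>R b)"
    by (auto simp: dim_UNIV)
  obtain q where q: "bij_betw q (UNIV::'n set) B"
    using B by (metis finite_same_card_bij finite_class.finite_UNIV)
  then have qB: "q i \<in> B" for i by (auto simp: bij_betw_def)
  then have "\<forall>i. \<exists>c. A *v q i = c *\<^sub>R q i" using B(4) by blast
  from choice[OF this] obtain a where "\<forall>i. A *v q i = a i *\<^sub>R q i" by (rule exE)
  then have a: "A *v q i = a i *\<^sub>R q i" for i by (rule spec)
  \<comment> \<open>With the eigenvectors as columns, \<open>A ** Q = Q ** diag_mat a\<close> is the
    list of eigenvalue equations, column by column.\<close>
  define Q :: "real^'n^'n" where "Q = (\<chi> i j. q j $ i)"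
  have col: "column i Q = q i" for i by (simp add: Q_def column_def vec_eq_iff)
  have Q: "orthogonal_matrix Q"
    unfolding orthogonal_matrix_orthonormal_columns col
  proof (intro conjI allI impI)
    show "norm (q i) = 1" for i using B(4) qB by blast
    fix i j :: 'n assume "i \<noteq> j"
    then have "q i \<noteq> q j" using q by (auto simp: bij_betw_def inj_on_def)
    then show "orthogonal (q i) (q j)" using B(3) qB by (auto simp: pairwise_def)
  qed
  have "A ** Q = Q ** diag_mat a"
  proof -
    have "(A ** Q) $ i $ j = (Q ** diag_mat a) $ i $ j" for i j
    proof -
      have "(A ** Q) $ i $ j = (A *v q j) $ i"
        by (simp add: matrix_matrix_mult_def matrix_vector_mult_def Q_def)
      also have "\<dots> = (Q ** diag_mat a) $ i $ j"
        by (simp add: a matrix_matrix_mult_def Q_def diag_mat_def if_distrib cong: if_cong)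
      finally show ?thesis .
    qed
    then show ?thesis by (simp add: vec_eq_iff)
  qed
  then have "A = Q ** diag_mat a ** transpose Q"
    using Q by (metis matrix_mul_assoc matrix_mul_rid orthogonal_matrix_def)
  with Q show ?thesis by (rule that)
qed

lemma diag_mat_mult_vec: "diag_mat a *v x = (\<chi> i. a i * x $ i)"
  by (simp add: diag_mat_def matrix_vector_mult_def vec_eq_iff if_distrib[of "\<lambda>z. z * _"] cong: if_cong)

lemma trace_orthogonal_conjugate:
  fixes D :: "real^'n^'n"
  assumes "orthogonal_matrix Q"
  shows "trace (Q ** D ** transpose Q) = trace D"
proof -
  have "trace (Q ** D ** transpose Q) = trace (transpose Q ** Q ** D)"
    by (metis trace_mul_sym matrix_mul_assoc)
  also have "transpose Q ** Q = mat 1" using assms by (simp add: orthogonal_matrix_def)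
  finally show ?thesis by simp
qed

lemma transpose_diag_mat: "transpose (diag_mat a) = diag_mat a"
  by (auto simp: diag_mat_def transpose_def vec_eq_iff)

lemma trace_diag_mat: "trace (diag_mat a) = (\<Sum>i\<in>UNIV. a i)"
  by (simp add: trace_def diag_mat_def)

text \<open>The Euclidean norm of a matrix is its Frobenius norm. For symmetric \<open>A\<close> its
  square is the trace of \<open>A ** A\<close>, which conjugation by \<open>Q\<close>
  preserves.\<close>

lemma norm_diagonalization:
  fixes A :: "real^'n^'n"
  assumes Q: "orthogonal_matrix Q" and A: "A = Q ** diag_mat a ** transpose Q"
  shows "(norm A)\<^sup>2 = (\<Sum>i\<in>UNIV. (a i)\<^sup>2)"
proof -
  have "transpose A = A"
    unfolding A by (simp add: matrix_transpose_mul matrix_mul_assoc transpose_diag_mat)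
  then have sym: "A $ j $ i = A $ i $ j" for i j by (metis (no_types) transpose_def vec_lambda_beta)
  have dd: "diag_mat a ** diag_mat a = diag_mat (\<lambda>i. (a i)\<^sup>2)"
    by (simp add: diag_mat_def matrix_matrix_mult_def vec_eq_iff power2_eq_square
        if_distrib[of "\<lambda>z. z * _"] cong: if_cong)
  have "(norm A)\<^sup>2 = (\<Sum>i\<in>UNIV. \<Sum>j\<in>UNIV. (A $ i $ j)\<^sup>2)"
    by (simp add: norm_vec_def L2_set_def sum_nonneg)
  also have "\<dots> = trace (A ** A)"
    by (simp add: trace_def matrix_matrix_mult_def power2_eq_square sym)
  also have "A ** A = Q ** diag_mat a ** (transpose Q ** Q) ** diag_mat a ** transpose Q"
    unfolding A by (simp only: matrix_mul_assoc)
  also have "transpose Q ** Q = mat 1" using Q by (simp add: orthogonal_matrix_def)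
  also have "Q ** diag_mat a ** mat 1 ** diag_mat a ** transpose Q
      = Q ** (diag_mat a ** diag_mat a) ** transpose Q"
    by (simp only: matrix_mul_assoc matrix_mul_rid)
  also have "\<dots> = Q ** diag_mat (\<lambda>i. (a i)\<^sup>2) ** transpose Q"
    by (simp only: dd)
  also have "trace \<dots> = (\<Sum>i\<in>UNIV. (a i)\<^sup>2)"
    unfolding trace_orthogonal_conjugate[OF Q] trace_diag_mat ..
  finally show ?thesis .
qed

text \<open>The operator norm is tested on the \<open>i\<close>-th column of \<open>Q\<close>, a
  unit eigenvector for \<open>a i\<close>.\<close>

lemma abs_eigenvalue_le_onorm:
  fixes A :: "real^'n^'n"
  assumes Q: "orthogonal_matrix Q" and A: "A = Q ** diag_mat a ** transpose Q"
  shows "\<bar>a i\<bar> \<le> onorm ((*v) A)"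
proof -
  have "A *v (Q *v axis i 1) = Q *v (diag_mat a *v ((transpose Q ** Q) *v axis i 1))"
    by (simp add: A matrix_vector_mul_assoc matrix_mul_assoc)
  also have "\<dots> = a i *\<^sub>R (Q *v axis i 1)"
  proof -
    have "diag_mat a *v axis i 1 = a i *\<^sub>R axis i 1"
      by (auto simp: diag_mat_mult_vec vec_eq_iff axis_def)
    then show ?thesis using Q by (simp add: orthogonal_matrix_def matrix_vector_mult_scaleR)
  qed
  finally have "norm (A *v (Q *v axis i 1)) = \<bar>a i\<bar> * norm (Q *v axis i 1)" by simp
  moreover have "norm (Q *v axis i 1) = 1"
    using Q orthogonal_matrix_orthonormal_columns[of Q] by (simp add: matrix_vector_mult_basis)
  moreover have "norm (A *v (Q *v axis i 1)) \<le> onorm ((*v) A) * norm (Q *v axis i 1)"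
    by (rule onorm) (simp add: matrix_vector_mul_bounded_linear)
  ultimately show ?thesis by simp
qed

lemma quadratic_form_diagonalization:
  fixes A :: "real^'n^'n"
  assumes A: "A = Q ** diag_mat a ** transpose Q"
  shows "x \<bullet> (A *v x) = (\<Sum>i\<in>UNIV. a i * ((transpose Q *v x) $ i)\<^sup>2)"
proof -
  have "x \<bullet> (A *v x) = x \<bullet> (Q *v (diag_mat a *v (transpose Q *v x)))"
    by (simp add: A matrix_vector_mul_assoc matrix_mul_assoc del: transpose_matrix_vector)
  also have "\<dots> = (transpose Q *v x) \<bullet> (diag_mat a *v (transpose Q *v x))"
    by (metis dot_lmul_matrix transpose_matrix_vector)
  finally show ?thesis
    by (simp add: diag_mat_mult_vec inner_vec_def power2_eq_square mult_ac)
qed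

section \<open>Gaussian quadratic forms\<close>

text \<open>The difference of the two sides vanishes at 0 and has derivative
  \<open>x\<^sup>2 / (2 * (1 - x)\<^sup>2)\<close>.\<close>

lemma ln_one_minus_lower_bound:
  fixes y :: real
  assumes "0 \<le> y" "y < 1"
  shows "- ln (1 - y) \<le> y + y\<^sup>2 / (2 * (1 - y))"
proof -
  let ?f = "\<lambda>y::real. y + y\<^sup>2 / (2 * (1 - y)) + ln (1 - y)"
  have "?f 0 \<le> ?f y"
  proof (rule DERIV_nonneg_imp_nondecreasing[OF assms(1)])
    fix x :: real assume x: "0 \<le> x" "x \<le> y"
    then have x1: "x < 1" using assms by simp
    have "(?f has_real_derivative
        1 + (2 * x * (2 * (1 - x)) - x\<^sup>2 * (- 2)) / (2 * (1 - x))\<^sup>2 + (- 1) / (1 - x)) (at x)"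
      using x1 by (auto intro!: derivative_eq_intros simp: power2_eq_square)
    moreover have "1 + (2 * x * (2 * (1 - x)) - x\<^sup>2 * (- 2)) / (2 * (1 - x))\<^sup>2 + (- 1) / (1 - x)
        = x\<^sup>2 / (2 * (1 - x)\<^sup>2)"
      using x1 by (simp add: divide_simps) (simp add: algebra_simps power2_eq_square)
    ultimately show "\<exists>D. (?f has_real_derivative D) (at x) \<and> 0 \<le> D"
      by (intro exI conjI) auto
  qed
  then show ?thesis by simp
qed

lemma ln_one_plus_ge_quadratic:
  fixes y :: real
  assumes "0 \<le> y"
  shows "y - y\<^sup>2 / 2 \<le> ln (1 + y)"
proof -
  let ?f = "\<lambda>y::real. ln (1 + y) - y + y\<^sup>2 / 2"
  have "?f 0 \<le> ?f y"
  proof (rule DERIV_nonneg_imp_nondecreasing[OF assms(1)])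
    fix x :: real assume x: "0 \<le> x" "x \<le> y"
    have "(?f has_real_derivative 1 / (1 + x) - 1 + x) (at x)"
      using x by (auto intro!: derivative_eq_intros simp: power2_eq_square)
    moreover have "1 / (1 + x) - 1 + x = x\<^sup>2 / (1 + x)"
      using x by (simp add: field_simps power2_eq_square)
    ultimately show "\<exists>D. (?f has_real_derivative D) (at x) \<and> 0 \<le> D"
      using x by (intro exI[of _ "x\<^sup>2 / (1 + x)"] conjI) auto
  qed
  then show ?thesis by simp
qed

text \<open>The left side is the moment generating function of a squared standard normal variable.
  The two logarithm estimates treat the two signs of \<open>x\<close>. Only an upper bound on
  \<open>x\<close> enters, so the negative coefficients of a quadratic form may be arbitrarily large
  in modulus.\<close>

lemma inverse_sqrt_le_exp:
  fixes x B :: real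
  assumes "x \<le> B" "0 \<le> B" "B < 1 / 2"
  shows "1 / sqrt (1 - 2 * x) \<le> exp (x + x\<^sup>2 / (1 - 2 * B))"
proof -
  have pos: "0 < 1 - 2 * x" "0 < 1 - 2 * B" using assms by auto
  have "- ln (1 - 2 * x) \<le> 2 * (x + x\<^sup>2 / (1 - 2 * B))"
  proof (cases "x \<ge> 0")
    case True
    have "x\<^sup>2 / (1 - 2 * x) \<le> x\<^sup>2 / (1 - 2 * B)"
      using pos assms by (intro divide_left_mono) auto
    moreover have "(2 * x)\<^sup>2 / (2 * (1 - 2 * x)) = 2 * (x\<^sup>2 / (1 - 2 * x))"
      using pos by (simp add: field_simps power2_eq_square)
    ultimately show ?thesis using ln_one_minus_lower_bound[of "2 * x"] True pos by simp
  next
    case False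
    have "- 2 * x - (- 2 * x)\<^sup>2 / 2 \<le> ln (1 + - 2 * x)"
      using False by (intro ln_one_plus_ge_quadratic) simp
    then have "- ln (1 - 2 * x) \<le> 2 * x + 2 * x\<^sup>2" by (simp add: power2_eq_square)
    moreover have "x\<^sup>2 / 1 \<le> x\<^sup>2 / (1 - 2 * B)"
      using pos assms by (intro divide_left_mono) auto
    ultimately show ?thesis by simp
  qed
  then have "ln (1 / sqrt (1 - 2 * x)) \<le> x + x\<^sup>2 / (1 - 2 * B)"
    using pos by (simp add: ln_div ln_sqrt)
  then have "exp (ln (1 / sqrt (1 - 2 * x))) \<le> exp (x + x\<^sup>2 / (1 - 2 * B))" by simp
  then show ?thesis using pos by simp
qed

section \<open>The standard Gaussian vector and its quadratic forms\<close>

lemma nn_integral_lborel_prod_cart: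
  fixes f :: "'n::finite \<Rightarrow> real \<Rightarrow> ennreal"
  assumes [measurable]: "\<And>i. f i \<in> borel_measurable borel"
  shows "(\<integral>\<^sup>+x. (\<Prod>i\<in>UNIV. f i (x $ i)) \<partial>(lborel :: (real^'n) measure)) = (\<Prod>i\<in>UNIV. \<integral>\<^sup>+y. f i y \<partial>lborel)"
proof -
  \<comment> \<open>The product formula for Lebesgue measure is indexed by \<open>Basis\<close>; the
    description recovers the coordinate from its basis vector.\<close>
  define g where "g b = f (THE i. b = axis i (1::real))" for b :: "real^'n"
  have g: "g (axis i 1) = f i" for i by (simp add: g_def axis_eq_axis)
  have B: "(Basis :: (real^'n) set) = range (\<lambda>i. axis i 1)" by (auto simp: Basis_vec_def)
  have inj: "inj (\<lambda>i::'n. axis i (1::real))" by (auto simp: inj_on_def axis_eq_axis)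
  have "(\<integral>\<^sup>+x. (\<Prod>b\<in>Basis. g b (x \<bullet> b)) \<partial>(lborel :: (real^'n) measure)) = (\<Prod>b\<in>Basis. \<integral>\<^sup>+y. g b y \<partial>lborel)"
    by (rule nn_integral_lborel_prod) (auto simp: B g)
  then show ?thesis
    unfolding B by (simp add: prod.reindex[OF inj] g inner_axis)
qed

definition gaussian_vec :: "(real^'n) measure" where
  "gaussian_vec = density lborel (\<lambda>x. \<Prod>i\<in>UNIV. ennreal (std_normal_density (x $ i)))"

lemma sets_gaussian_vec [simp, measurable_cong]: "sets gaussian_vec = sets borel"
  and space_gaussian_vec [simp]: "space gaussian_vec = UNIV"
  by (simp_all add: gaussian_vec_def)

lemma nn_integral_gaussian_vec_prod:
  fixes f :: "'n::finite \<Rightarrow> real \<Rightarrow> ennreal"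
  assumes [measurable]: "\<And>i. f i \<in> borel_measurable borel"
  shows "(\<integral>\<^sup>+x. (\<Prod>i\<in>UNIV. f i (x $ i)) \<partial>gaussian_vec)
    = (\<Prod>i\<in>UNIV. \<integral>\<^sup>+y. ennreal (std_normal_density y) * f i y \<partial>lborel)"
proof -
  have "(\<integral>\<^sup>+x. (\<Prod>i\<in>UNIV. f i (x $ i)) \<partial>gaussian_vec)
      = (\<integral>\<^sup>+x. (\<Prod>i\<in>UNIV. ennreal (std_normal_density (x $ i))) * (\<Prod>i\<in>UNIV. f i (x $ i)) \<partial>lborel)"
    unfolding gaussian_vec_def by (rule nn_integral_density) measurable
  also have "\<dots> = (\<integral>\<^sup>+x. (\<Prod>i\<in>UNIV. ennreal (std_normal_density (x $ i)) * f i (x $ i)) \<partial>lborel)"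
    by (simp only: prod.distrib)
  also have "\<dots> = (\<Prod>i\<in>UNIV. \<integral>\<^sup>+y. ennreal (std_normal_density y) * f i y \<partial>lborel)"
    by (rule nn_integral_lborel_prod_cart) measurable
  finally show ?thesis .
qed

lemma nn_integral_normal_density:
  assumes "\<sigma> > 0"
  shows "(\<integral>\<^sup>+x. ennreal (normal_density m \<sigma> x) \<partial>lborel) = 1"
  using prob_space.emeasure_space_1[OF prob_space_normal_density[OF assms, of m]]
  by (simp add: emeasure_density)

lemma prob_space_gaussian_vec: "prob_space (gaussian_vec :: (real^'n) measure)"
proof
  have "(\<integral>\<^sup>+x. (\<Prod>i\<in>UNIV. 1) \<partial>(gaussian_vec :: (real^'n) measure)) = 1"
    using nn_integral_gaussian_vec_prod[where f="\<lambda>(_::'n) _. 1"] by (simp add: nn_integral_normal_density)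
  then show "emeasure (gaussian_vec :: (real^'n) measure) (space gaussian_vec) = 1" by simp
qed

text \<open>Up to the factor \<open>\<sigma>\<close>, the integrand is the centred normal density of
  variance \<open>1 / (1 - 2 * s)\<close>.\<close>

lemma nn_integral_exp_square_std_normal:
  assumes "s < 1 / 2"
  shows "(\<integral>\<^sup>+x. ennreal (std_normal_density x) * ennreal (exp (s * x\<^sup>2)) \<partial>lborel) = ennreal (1 / sqrt (1 - 2 * s))"
proof -
  define \<sigma> where "\<sigma> = 1 / sqrt (1 - 2 * s)"
  have \<sigma>: "\<sigma> > 0" "\<sigma>\<^sup>2 = 1 / (1 - 2 * s)" using assms by (auto simp: \<sigma>_def power_divide)
  have "std_normal_density x * exp (s * x\<^sup>2) = \<sigma> * normal_density 0 \<sigma> x" for x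
  proof -
    have "- x\<^sup>2 / 2 + s * x\<^sup>2 = - (x\<^sup>2 / (2 * \<sigma>\<^sup>2))" using assms by (simp add: \<sigma>(2) field_simps)
    moreover have "sqrt (2 * pi * \<sigma>\<^sup>2) = sqrt (2 * pi) * \<sigma>"
      using \<sigma>(1) by (simp add: real_sqrt_mult)
    ultimately show ?thesis
      using \<sigma>(1) by (simp add: std_normal_density_def normal_density_def flip: exp_add)
  qed
  then have "ennreal (std_normal_density x) * ennreal (exp (s * x\<^sup>2)) = ennreal \<sigma> * ennreal (normal_density 0 \<sigma> x)" for x
    using \<sigma>(1) by (simp flip: ennreal_mult')
  then show ?thesis using \<sigma>(1) by (simp add: nn_integral_cmult nn_integral_normal_density flip: \<sigma>_def)
qed

text \<open>A Chernoff bound at level 0: the deviation is encoded in the negative sum of the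
  coefficients. Independence turns the exponential moment into a product of one-dimensional
  ones.\<close>

lemma gaussian_quadratic_tail:
  fixes c :: "'n::finite \<Rightarrow> real"
  assumes a: "0 \<le> a" and W: "0 \<le> W" and b: "0 \<le> b"
    and cb: "\<And>i. c i \<le> b" and sq: "(\<Sum>i\<in>UNIV. (c i)\<^sup>2) \<le> W\<^sup>2"
    and s: "(\<Sum>i\<in>UNIV. c i) \<le> - (2 * a * W + 2 * a\<^sup>2 * b)"
  shows "measure gaussian_vec {x. (\<Sum>i\<in>UNIV. c i * (x $ i)\<^sup>2) > 0} \<le> exp (- a\<^sup>2)"
\<comment> \<open>In the degenerate case all coefficients vanish and the event is empty. Otherwise
  \<open>W > 0\<close> keeps both \<open>W + 2 * a * b\<close> and \<open>1 - 2 * (l * b)\<close>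
  positive.\<close>
proof (cases "W = 0")
  case True
  then have "(\<Sum>i\<in>UNIV. (c i)\<^sup>2) = 0" using sq by (simp add: antisym sum_nonneg)
  then have "c i = 0" for i by (simp add: sum_nonneg_eq_0_iff)
  then show ?thesis by simp
next
  case False
  then have W: "W > 0" using W by simp
  interpret prob_space "gaussian_vec :: (real^'n) measure" by (rule prob_space_gaussian_vec)
  \<comment> \<open>the Chernoff parameter that minimises \<open>l\<^sup>2 W\<^sup>2 / (1 - 2 l b) - l (2 a W + 2 a\<^sup>2 b)\<close>\<close>
  define l where "l = a / (W + 2 * a * b)"
  have D: "W + 2 * a * b > 0" using W a b by (simp add: add_pos_nonneg)
  have l: "l \<ge> 0" using a D by (simp add: l_def)
  have lb: "1 - 2 * (l * b) = W / (W + 2 * a * b)" using D by (simp add: l_def field_simps)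
  have lbpos: "1 - 2 * (l * b) > 0" unfolding lb using W D by simp
  have lc: "l * c i \<le> l * b" for i using cb l by (simp add: mult_left_mono)
  let ?q = "\<lambda>x::real^'n. \<Sum>i\<in>UNIV. c i * (x $ i)\<^sup>2"
  have "emeasure gaussian_vec {x. ?q x > 0} = (\<integral>\<^sup>+x. indicator {x. ?q x > 0} x \<partial>gaussian_vec)"
    by (rule nn_integral_indicator[symmetric]) simp
  also have "\<dots> \<le> (\<integral>\<^sup>+x. (\<Prod>i\<in>UNIV. ennreal (exp ((l * c i) * (x $ i)\<^sup>2))) \<partial>gaussian_vec)"
  proof (rule nn_integral_mono)
    fix x :: "real^'n"
    have "(\<Prod>i\<in>UNIV. ennreal (exp ((l * c i) * (x $ i)\<^sup>2))) = ennreal (exp (l * ?q x))"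
      by (simp add: prod_ennreal exp_sum sum_distrib_left mult.assoc)
    moreover have "1 \<le> exp (l * ?q x)" if "?q x > 0" using that l by simp
    ultimately show "indicator {x. ?q x > 0} x \<le> (\<Prod>i\<in>UNIV. ennreal (exp ((l * c i) * (x $ i)\<^sup>2)))"
      by (simp add: indicator_def)
  qed
  also have "\<dots> = (\<Prod>i\<in>UNIV. ennreal (1 / sqrt (1 - 2 * (l * c i))))"
  proof -
    have "l * c i < 1 / 2" for i using lc[of i] lbpos by simp
    then show ?thesis
      by (subst nn_integral_gaussian_vec_prod) (simp_all add: nn_integral_exp_square_std_normal)
  qed
  also have "\<dots> \<le> (\<Prod>i\<in>UNIV. ennreal (exp (l * c i + (l * c i)\<^sup>2 / (1 - 2 * (l * b)))))"
    using lc lbpos l b by (intro prod_mono_ennreal ennreal_leI inverse_sqrt_le_exp) auto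
  also have "\<dots> = ennreal (exp (l * (\<Sum>i\<in>UNIV. c i) + l\<^sup>2 * (\<Sum>i\<in>UNIV. (c i)\<^sup>2) / (1 - 2 * (l * b))))"
    by (simp add: prod_ennreal sum_distrib_left sum_divide_distrib power_mult_distrib
        flip: exp_sum sum.distrib)
  also have "\<dots> \<le> ennreal (exp (- a\<^sup>2))"
  proof -
    have "l * (\<Sum>i\<in>UNIV. c i) \<le> l * (- (2 * a * W + 2 * a\<^sup>2 * b))" using s l by (rule mult_left_mono)
    moreover have "l\<^sup>2 * (\<Sum>i\<in>UNIV. (c i)\<^sup>2) / (1 - 2 * (l * b)) \<le> l\<^sup>2 * W\<^sup>2 / (1 - 2 * (l * b))"
      using sq lbpos by (intro divide_right_mono mult_left_mono) auto
    \<comment> \<open>With \<open>D = W + 2 * a * b\<close> the two terms are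
      \<open>- 2 * a\<^sup>2 * (W + a * b) / D\<close> and \<open>a\<^sup>2 * W / D\<close>.\<close>
    moreover have "l * (- (2 * a * W + 2 * a\<^sup>2 * b)) + l\<^sup>2 * W\<^sup>2 / (1 - 2 * (l * b)) = - a\<^sup>2"
      unfolding lb l_def using D W by (simp add: divide_simps) (simp add: algebra_simps power2_eq_square)
    ultimately show ?thesis by (intro ennreal_leI) simp
  qed
  finally show ?thesis by (simp add: emeasure_eq_measure)
qed

section \<open>Nets of the unit sphere\<close>

text \<open>Volume comparison: the balls of radius 1/8 around the points are disjoint and lie in the
  ball of radius 9/8, and the ratio of the radii is 9.\<close>

lemma card_separated_unit_sphere:
  fixes N :: "'a::euclidean_space set"
  assumes "finite N" "N \<subseteq> sphere 0 1" and sep: "\<And>x y. x \<in> N \<Longrightarrow> y \<in> N \<Longrightarrow> x \<noteq> y \<Longrightarrow> 1/4 \<le> dist x y"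
  shows "card N \<le> 9 ^ DIM('a)"
proof -
  define w where "w = measure lborel (ball (0::'a) 1)"
  have w: "w > 0" by (simp add: w_def)
  have disj: "disjoint_family_on (\<lambda>x. ball x (1/8)) N"
    unfolding disjoint_family_on_def
  proof (intro ballI impI)
    fix x y assume "x \<in> N" "y \<in> N" "x \<noteq> y"
    then have "1/4 \<le> dist x y" by (rule sep)
    then show "ball x (1/8) \<inter> ball y (1/8) = {}"
      by (intro disjoint_ballI) simp
  qed
  have "real (card N) * ((1/8) ^ DIM('a) * w) = (\<Sum>x\<in>N. measure lborel (ball x (1/8)))"
    by (simp add: content_ball_conv_unit_ball[of "1/8"] w_def)
  also have "\<dots> = measure lborel (\<Union>x\<in>N. ball x (1/8))"
    using assms(1) disj emeasure_lborel_ball_finite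
    by (intro measure_finite_Union[symmetric]) (auto simp: less_top[symmetric] emeasure_lborel_ball_finite)
  also have "\<dots> \<le> measure lborel (ball (0::'a) (9/8))"
  proof (rule measure_mono_fmeasurable)
    show "(\<Union>x\<in>N. ball x (1/8)) \<subseteq> ball 0 (9/8)"
    proof
      fix y assume "y \<in> (\<Union>x\<in>N. ball x (1/8))"
      then obtain x where x: "x \<in> N" "norm (y - x) < 1/8" by (auto simp: dist_norm norm_minus_commute)
      then have "norm x = 1" using assms(2) by auto
      with x norm_triangle_ineq2[of y x] show "y \<in> ball 0 (9/8)" by simp
    qed
    show "(\<Union>x\<in>N. ball x (1/8)) \<in> sets lborel" using assms(1) by (intro sets.finite_UN) auto
    show "ball 0 (9/8) \<in> fmeasurable lborel"
      by (rule fmeasurableI) (auto intro: emeasure_lborel_ball_finite[unfolded infinity_ennreal_def])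
  qed
  also have "\<dots> = (9/8) ^ DIM('a) * w" by (simp add: content_ball_conv_unit_ball[of "9/8"] w_def)
  finally have "real (card N) \<le> 9 ^ DIM('a)"
    using w by (simp add: field_simps power_divide)
  then show ?thesis by (metis of_nat_le_iff of_nat_numeral of_nat_power)
qed

text \<open>A separated set of maximal cardinality is a net, since a point far from all its members
  could be added. The volume bound guarantees that a maximum exists.\<close>

lemma unit_sphere_net:
  obtains N :: "'a::euclidean_space set" where "finite N" "N \<subseteq> sphere 0 1" "card N \<le> 9 ^ DIM('a)"
    "\<And>y. norm y = 1 \<Longrightarrow> \<exists>x\<in>N. dist x y < 1/4"
proof -
  define P where "P N \<longleftrightarrow> finite N \<and> N \<subseteq> sphere (0::'a) 1 \<and> (\<forall>x\<in>N. \<forall>y\<in>N. x \<noteq> y \<longrightarrow> 1/4 \<le> dist x y)" for N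
  have bound: "card N \<le> 9 ^ DIM('a)" if "P N" for N
    using that by (intro card_separated_unit_sphere) (auto simp: P_def)
  have "P {}" by (simp add: P_def)
  then obtain N where N: "P N" and max: "\<And>N'. P N' \<Longrightarrow> card N' \<le> card N"
    \<comment> \<open>The existence principle is used with a strict upper bound, hence the
      successor.\<close>
    using ex_has_greatest_nat[of P "{}" card "Suc (9 ^ DIM('a))"] bound by (meson le_imp_less_Suc)
  show ?thesis
  proof (rule that[of N])
    fix y :: 'a assume y: "norm y = 1"
    show "\<exists>x\<in>N. dist x y < 1/4"
    proof (rule ccontr)
      assume far: "\<not> ?thesis"
      then have "y \<notin> N" by force
      have "P (insert y N)" using N far y by (auto simp: P_def dist_commute not_less)
      from max[OF this] show False using \<open>y \<notin> N\<close> N by (simp add: P_def)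
    qed
  qed (use N bound in \<open>auto simp: P_def\<close>)
qed

section \<open>Operator norm of a symmetric matrix from its quadratic form\<close>

text \<open>Polarisation bounds the bilinear form on unit vectors: the parallelogram law turns the
  two quadratic terms into \<open>4 * w\<close>. Testing \<open>X *v y\<close> against its own
  direction then bounds its norm.\<close>

lemma onorm_symmetric_le:
  fixes X :: "real^'n^'n"
  assumes sym: "transpose X = X" and le: "\<And>x. norm x = 1 \<Longrightarrow> \<bar>x \<bullet> (X *v x)\<bar> \<le> w"
  shows "onorm ((*v) X) \<le> w"
proof -
  have sa: "(X *v x) \<bullet> y = x \<bullet> (X *v y)" for x y
    by (metis sym dot_lmul_matrix vector_transpose_matrix)
  have le': "\<bar>x \<bullet> (X *v x)\<bar> \<le> w * (norm x)\<^sup>2" for x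
  proof (cases "x = 0")
    case False
    then have "\<bar>(x /\<^sub>R norm x) \<bullet> (X *v (x /\<^sub>R norm x))\<bar> \<le> w" by (intro le) simp
    then have "\<bar>x \<bullet> (X *v x)\<bar> / (norm x)\<^sup>2 \<le> w"
      by (simp add: matrix_vector_mult_scaleR power2_eq_square abs_mult divide_inverse mult_ac)
    then show ?thesis using False by (simp add: divide_le_eq)
  qed simp
  have "norm (axis undefined 1 :: real^'n) = 1" by simp
  from le[OF this] have w: "w \<ge> 0" by linarith
  have polarisation: "z \<bullet> (X *v y) \<le> w" if "norm y = 1" "norm z = 1" for y z
  proof -
    have "4 * (z \<bullet> (X *v y)) = (y + z) \<bullet> (X *v (y + z)) - (y - z) \<bullet> (X *v (y - z))"
      using sa[of z y] by (simp add: matrix_vector_right_distrib matrix_vector_mult_diff_distrib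
          inner_add_left inner_add_right inner_diff_left inner_diff_right inner_commute)
    also have "\<dots> \<le> w * (norm (y + z))\<^sup>2 + w * (norm (y - z))\<^sup>2"
      using le'[of "y + z"] le'[of "y - z"] by linarith
    also have "\<dots> = 4 * w"
      using that by (simp add: power2_norm_eq_inner norm_eq_1 inner_add_left inner_add_right
          inner_diff_left inner_diff_right inner_commute algebra_simps)
    finally show ?thesis by simp
  qed
  have unit: "norm (X *v y) \<le> w" if y: "norm y = 1" for y
  proof (cases "X *v y = 0")
    case False
    have "((X *v y) /\<^sub>R norm (X *v y)) \<bullet> (X *v y) \<le> w"
      using False y by (intro polarisation) auto
    then show ?thesis using False by (simp add: power2_norm_eq_inner[symmetric] power2_eq_square mult.assoc[symmetric])
  qed (use w in simp)
  show ?thesis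
  proof (rule onorm_le)
    fix x
    show "norm (X *v x) \<le> w * norm x"
    proof (cases "x = 0")
      case False
      have "norm (X *v (x /\<^sub>R norm x)) \<le> w" using False by (intro unit) simp
      then show ?thesis using False by (simp add: matrix_vector_mult_scaleR field_simps)
    qed simp
  qed
qed

text \<open>Replacing a unit vector by a net point at distance below 1/4 changes the quadratic form
  by at most half the operator norm, as each of the two arguments contributes a quarter. That half
  is absorbed on the left.\<close>

lemma onorm_symmetric_le_net:
  fixes X :: "real^'n^'n"
  assumes sym: "transpose X = X" and N: "N \<subseteq> sphere 0 1"
    and net: "\<And>y. norm y = 1 \<Longrightarrow> \<exists>x\<in>N. dist x y < 1/4"
    and le: "\<And>x. x \<in> N \<Longrightarrow> \<bar>x \<bullet> (X *v x)\<bar> \<le> m"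
  shows "onorm ((*v) X) \<le> 2 * m"
proof -
  let ?o = "onorm ((*v) X)"
  have bl: "bounded_linear ((*v) X)" by simp
  have sa: "(X *v x) \<bullet> y = x \<bullet> (X *v y)" for x y
    by (metis sym dot_lmul_matrix vector_transpose_matrix)
  have bil: "\<bar>u \<bullet> (X *v v)\<bar> \<le> norm u * (?o * norm v)" for u v
    using Cauchy_Schwarz_ineq2[of u "X *v v"] onorm[OF bl, of v]
    by (meson mult_left_mono norm_ge_zero order_trans)
  have o: "?o \<ge> 0" by (rule onorm_pos_le[OF bl])
  have "?o \<le> m + ?o / 2"
  proof (rule onorm_symmetric_le[OF sym])
    fix y :: "real^'n" assume y: "norm y = 1"
    from net[OF y] obtain x where x: "x \<in> N" "dist x y < 1/4" by auto
    then have nx: "norm x = 1" using N by auto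
    have "y \<bullet> (X *v y) = x \<bullet> (X *v x) + (y - x) \<bullet> (X *v y) + x \<bullet> (X *v (y - x))"
      by (simp add: matrix_vector_mult_diff_distrib inner_diff_left inner_diff_right)
    moreover have "\<bar>(y - x) \<bullet> (X *v y)\<bar> \<le> norm (y - x) * ?o" using bil[of "y - x" y] y by simp
    moreover have "\<bar>x \<bullet> (X *v (y - x))\<bar> \<le> norm (y - x) * ?o" using bil[of x "y - x"] nx by (simp add: mult.commute)
    moreover have "norm (y - x) * ?o \<le> 1/4 * ?o"
      using x(2) o by (intro mult_right_mono) (auto simp: dist_norm norm_minus_commute)
    ultimately show "\<bar>y \<bullet> (X *v y)\<bar> \<le> m + ?o / 2" using le[OF x(1)] by linarith
  qed
  then show ?thesis by simp
qed

text \<open>This is where the constant 2.2, slightly above \<open>ln 9\<close>, comes from. Six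
  terms of the exponential series at 1.1 just exceed 3 (five do not), and squaring gives 9.\<close>

lemma nine_power_le_exp: "(9::real) ^ n \<le> exp (2.2 * real n)"
proof -
  have "(3::real) \<le> (\<Sum>k<6. (1.1::real) ^ k /\<^sub>R fact k)"
    by (simp add: lessThan_Suc numeral_eq_Suc fact_numeral)
  also have "\<dots> \<le> exp (1.1::real)"
    unfolding exp_def by (rule sum_le_suminf[OF summable_exp_generic]) auto
  finally have "3 * 3 \<le> exp (1.1::real) * exp 1.1" by (intro mult_mono) auto
  then have "9 \<le> exp (2.2::real)" by (simp flip: exp_add)
  then have "9 ^ n \<le> exp (2.2::real) ^ n" by (intro power_mono) auto
  then show ?thesis by (simp add: exp_of_nat_mult[symmetric] mult.commute)
qed

section \<open>Uniform measures on the sphere and the Stiefel manifold\<close>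

text \<open>The density depends on \<open>x\<close> only through its norm, and Lebesgue measure is
  invariant under \<open>T\<close>.\<close>

lemma distr_gaussian_vec_orthogonal_transformation:
  fixes T :: "real^'n \<Rightarrow> real^'n"
  assumes T: "orthogonal_transformation T"
  shows "distr gaussian_vec borel T = gaussian_vec"
proof -
  note [measurable] = orthogonal_transformation_borel_measurable[OF T]
  define f where "f x = (\<Prod>i\<in>UNIV. ennreal (std_normal_density (x $ i)))" for x :: "real^'n"
  have [measurable]: "f \<in> borel_measurable borel" unfolding f_def by measurable
  have f: "f x = ennreal ((1 / sqrt (2 * pi)) ^ CARD('n) * exp (- ((norm x)\<^sup>2 / 2)))" for x
  proof -
    have "(norm x)\<^sup>2 = (\<Sum>i\<in>UNIV. (x $ i)\<^sup>2)"
      by (simp add: norm_vec_def L2_set_def sum_nonneg)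
    then have "(\<Prod>i\<in>UNIV. exp (- (x $ i)\<^sup>2 / 2)) = exp (- ((norm x)\<^sup>2 / 2))"
      by (simp add: sum_negf sum_divide_distrib flip: exp_sum)
    moreover have "f x = ennreal (\<Prod>i\<in>UNIV. std_normal_density (x $ i))"
      by (simp add: f_def prod_ennreal)
    ultimately show ?thesis
      by (simp only: std_normal_density_def prod.distrib prod_constant)
  qed
  have fT: "f (T x) = f x" for x
    by (simp add: f orthogonal_transformation_norm[OF T])
  have "distr gaussian_vec borel T = distr (density lborel (\<lambda>x. f (T x))) borel T"
    unfolding fT by (simp add: gaussian_vec_def f_def)
  also have "\<dots> = density (distr lborel borel T) f"
    by (rule density_distr[symmetric]) measurable
  also have "\<dots> = gaussian_vec"
    unfolding lborel_distr_orthogonal_transformation[OF T] by (simp add: gaussian_vec_def f_def[abs_def])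
  finally show ?thesis .
qed

text \<open>Needed because \<open>x /\<^sub>R norm x\<close> is 0, not a unit vector, at the
  origin.\<close>

lemma AE_gaussian_vec_nonzero: "AE x in gaussian_vec. x \<noteq> (0 :: real^'n)"
proof -
  have "AE x in lborel. x \<noteq> (0 :: real^'n)" by (rule AE_lborel_singleton)
  then show ?thesis unfolding gaussian_vec_def by (subst AE_density) auto
qed

text \<open>Normalisation commutes with orthogonal maps, so the direction of a Gaussian vector
  inherits its invariance, and uniqueness on the sphere applies.\<close>

lemma sphere_measure_eq_gaussian_direction:
  fixes \<mu> :: "(real^'n) measure"
  assumes "prob_space \<mu>" and "sets \<mu> = sets borel" and "AE x in \<mu>. norm x = 1"
    and "\<And>T. orthogonal_transformation T \<Longrightarrow> distr \<mu> borel T = \<mu>"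
  shows "\<mu> = distr gaussian_vec borel (\<lambda>x. x /\<^sub>R norm x)"
proof (rule sphere_measure_unique)
  let ?g = "\<lambda>x::real^'n. x /\<^sub>R norm x"
  interpret g: prob_space "gaussian_vec :: (real^'n) measure" by (rule prob_space_gaussian_vec)
  have [measurable]: "?g \<in> borel_measurable borel" by measurable
  show "prob_space (distr gaussian_vec borel ?g)" by (rule g.prob_space_distr) measurable
  have "AE x in gaussian_vec. norm (?g x) = 1"
    using AE_gaussian_vec_nonzero by eventually_elim simp
  then show "AE x in distr gaussian_vec borel ?g. norm x = 1"
    by (subst AE_distr_iff) auto
  fix T :: "real^'n \<Rightarrow> real^'n" assume T: "orthogonal_transformation T"
  note [measurable] = orthogonal_transformation_borel_measurable[OF T]
  have "T (?g x) = ?g (T x)" for x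
    by (simp add: orthogonal_transformation_norm[OF T] orthogonal_transformation_scaleR[OF T])
  then have comm: "T \<circ> ?g = ?g \<circ> T" by (simp add: fun_eq_iff)
  have "distr (distr gaussian_vec borel ?g) borel T = distr gaussian_vec borel (T \<circ> ?g)"
    by (rule distr_distr) measurable
  also have "\<dots> = distr (distr gaussian_vec borel T) borel ?g"
    unfolding comm by (rule distr_distr[symmetric]) measurable
  also have "\<dots> = distr gaussian_vec borel ?g"
    unfolding distr_gaussian_vec_orthogonal_transformation[OF T] ..
  finally show "distr (distr gaussian_vec borel ?g) borel T = distr gaussian_vec borel ?g" .
qed (use assms in auto)

text \<open>The assumption \<open>large\<close> is the hypothesis of the Gaussian tail bound for
  \<open>W = norm A + sqrt d * \<theta>\<close> and \<open>b = 2 * K\<close>, the shifted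
  eigenvalues having sum \<open>- (d * \<theta>)\<close>.\<close>

lemma sphere_quadratic_tail:
  fixes \<mu> :: "(real^'n) measure" and A :: "real^'n^'n"
  defines "d \<equiv> real CARD('n)"
  assumes \<mu>: "prob_space \<mu>" and s\<mu>: "sets \<mu> = sets borel" and AE\<mu>: "AE x in \<mu>. norm x = 1"
    and T\<mu>: "\<And>T. orthogonal_transformation T \<Longrightarrow> distr \<mu> borel T = \<mu>"
    and A: "transpose A = A" and a: "0 \<le> a" and \<theta>: "0 \<le> \<theta>"
    and large: "2 * a * (norm A + sqrt d * \<theta>) + 4 * a\<^sup>2 * onorm ((*v) A) \<le> d * \<theta>"
  shows "measure \<mu> {x. x \<bullet> (A *v x) - trace A / d > \<theta>} \<le> exp (- a\<^sup>2)"
proof -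
  obtain Q \<alpha> where Q: "orthogonal_matrix Q" and AQ: "A = Q ** diag_mat \<alpha> ** transpose Q"
    using symmetric_matrix_diagonalization[OF A] .
  have d: "d > 0" by (simp add: d_def)
  define m where "m = trace A / d"
  have tr: "(\<Sum>i\<in>UNIV. \<alpha> i) = d * m"
    using d trace_orthogonal_conjugate[OF Q, of "diag_mat \<alpha>"] by (simp add: m_def AQ trace_diag_mat)
  have dm: "(\<Sum>i\<in>(UNIV :: 'n set). z) = d * z" for z :: real by (simp add: d_def)
  define K where "K = onorm ((*v) A)"
  have \<alpha>K: "\<bar>\<alpha> i\<bar> \<le> K" for i unfolding K_def by (rule abs_eigenvalue_le_onorm[OF Q AQ])
  have K: "K \<ge> 0" using \<alpha>K[of undefined] by linarith
  have "\<bar>d * m\<bar> \<le> (\<Sum>i\<in>(UNIV :: 'n set). K)"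
    unfolding tr[symmetric] by (rule order_trans[OF sum_abs sum_mono]) (rule \<alpha>K)
  then have "d * \<bar>m\<bar> \<le> d * K" unfolding dm using d by (simp add: abs_mult)
  then have mK: "\<bar>m\<bar> \<le> K" using d by (rule mult_left_le_imp_le)
  define c where "c i = \<alpha> i - m - \<theta>" for i
  have sum_c: "(\<Sum>i\<in>UNIV. c i) = - (d * \<theta>)"
    by (simp add: c_def sum_subtractf tr d_def)
  have "(\<Sum>i\<in>UNIV. (c i)\<^sup>2) = (\<Sum>i\<in>UNIV. (\<alpha> i)\<^sup>2) - 2 * (m + \<theta>) * (\<Sum>i\<in>UNIV. \<alpha> i) + d * (m + \<theta>)\<^sup>2"
  proof -
    have "(c i)\<^sup>2 = (\<alpha> i)\<^sup>2 - 2 * (m + \<theta>) * \<alpha> i + (m + \<theta>)\<^sup>2" for i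
      by (simp add: c_def power2_eq_square algebra_simps)
    then show ?thesis by (simp add: sum.distrib sum_subtractf sum_distrib_left d_def)
  qed
  also have "\<dots> = (norm A)\<^sup>2 - d * m\<^sup>2 + d * \<theta>\<^sup>2"
    unfolding tr norm_diagonalization[OF Q AQ] by (simp add: power2_eq_square algebra_simps)
  \<comment> \<open>Centring by \<open>m\<close> only decreases the sum of squares. The next step
    adds a nonnegative cross term to obtain a perfect square.\<close>
  also have "\<dots> \<le> (norm A)\<^sup>2 + d * \<theta>\<^sup>2" using d by simp
  also have "\<dots> \<le> (norm A + sqrt d * \<theta>)\<^sup>2"
    using d \<theta> by (simp add: power2_sum power_mult_distrib)
  finally have sq: "(\<Sum>i\<in>UNIV. (c i)\<^sup>2) \<le> (norm A + sqrt d * \<theta>)\<^sup>2" .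

  have tail: "measure gaussian_vec {x. (\<Sum>i\<in>UNIV. c i * (x $ i)\<^sup>2) > 0} \<le> exp (- a\<^sup>2)"
  proof (rule gaussian_quadratic_tail[OF a _ _ _ sq])
    \<comment> \<open>Both an eigenvalue and the mean \<open>m\<close> of all eigenvalues have
      modulus at most \<open>K\<close>.\<close>
    show "c i \<le> 2 * K" for i using \<alpha>K[of i] mK \<theta> by (simp add: c_def)
  qed (use d \<theta> K large in \<open>auto simp: sum_c K_def\<close>)
  have oT: "orthogonal_transformation ((*v) (transpose Q))"
    unfolding orthogonal_transformation_matrix using Q
    by (simp add: matrix_of_matrix_vector_mul del: transpose_matrix_vector)
  note [measurable] = orthogonal_transformation_borel_measurable[OF oT]
  let ?S = "{y. (\<Sum>i\<in>UNIV. \<alpha> i * (y $ i)\<^sup>2) - m > \<theta>} :: (real^'n) set"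
  have S[measurable]: "?S \<in> sets borel" by simp
  have meas: "(*v) (transpose Q) \<in> measurable \<mu> borel"
    unfolding measurable_cong_sets[OF s\<mu> refl] by measurable
  have "measure \<mu> {x. x \<bullet> (A *v x) - trace A / d > \<theta>} = measure (distr \<mu> borel ((*v) (transpose Q))) ?S"
  proof -
    have "space \<mu> = UNIV" using s\<mu> sets_eq_imp_space_eq by force
    then show ?thesis
      by (subst measure_distr[OF meas S])
        (simp add: quadratic_form_diagonalization[OF AQ] m_def vimage_def)
  qed
  \<comment> \<open>Invariance under \<open>transpose Q\<close> removes the change of basis.\<close>
  also have "\<dots> = measure \<mu> ?S" unfolding T\<mu>[OF oT] ..
  also have "\<dots> = measure (distr gaussian_vec borel (\<lambda>x::real^'n. x /\<^sub>R norm x)) ?S"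
    by (rule arg_cong[where f="\<lambda>M. measure M ?S"])
      (rule sphere_measure_eq_gaussian_direction[OF \<mu> s\<mu> AE\<mu> T\<mu>])
  also have "\<dots> = measure gaussian_vec ((\<lambda>x::real^'n. x /\<^sub>R norm x) -` ?S)"
    by (subst measure_distr) auto
  also have "\<dots> \<le> measure gaussian_vec {x. (\<Sum>i\<in>UNIV. c i * (x $ i)\<^sup>2) > 0}"
  proof -
    interpret g: prob_space "gaussian_vec :: (real^'n) measure" by (rule prob_space_gaussian_vec)
    have "AE x in gaussian_vec. x \<in> (\<lambda>x::real^'n. x /\<^sub>R norm x) -` ?S
        \<longrightarrow> x \<in> {x. (\<Sum>i\<in>UNIV. c i * (x $ i)\<^sup>2) > 0}"
      using AE_gaussian_vec_nonzero
    proof eventually_elim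
      fix x :: "real^'n" assume x: "x \<noteq> 0"
      have nx: "(norm x)\<^sup>2 = (\<Sum>i\<in>UNIV. (x $ i)\<^sup>2)"
        by (simp add: norm_vec_def L2_set_def sum_nonneg)
      have "(\<Sum>i\<in>UNIV. \<alpha> i * ((x /\<^sub>R norm x) $ i)\<^sup>2) = (\<Sum>i\<in>UNIV. \<alpha> i * (x $ i)\<^sup>2) / (norm x)\<^sup>2"
        by (simp add: sum_distrib_left power_mult_distrib divide_inverse power_inverse mult_ac)
      moreover have "(\<Sum>i\<in>UNIV. c i * (x $ i)\<^sup>2) = (\<Sum>i\<in>UNIV. \<alpha> i * (x $ i)\<^sup>2) - (m + \<theta>) * (norm x)\<^sup>2"
        by (simp add: c_def nx sum_distrib_left algebra_simps sum_subtractf sum.distrib)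
      ultimately show "x \<in> (\<lambda>x::real^'n. x /\<^sub>R norm x) -` ?S
          \<longrightarrow> x \<in> {x. (\<Sum>i\<in>UNIV. c i * (x $ i)\<^sup>2) > 0}"
        \<comment> \<open>Multiplication by \<open>(norm x)\<^sup>2 > 0\<close> clears the
          normalisation and gives a homogeneous condition on \<open>x\<close>.\<close>
        using x by (simp add: less_diff_eq less_divide_eq add.commute)
    qed
    then show ?thesis by (rule g.finite_measure_mono_AE) simp
  qed
  also note tail
  finally show ?thesis .
qed

section \<open>From the sphere to the Stiefel manifold\<close>

lemma matrix_vector_mult_left_borel_measurable:
  "(\<lambda>V. V *v x) \<in> borel_measurable (borel :: (real^'r^'d) measure)"
proof (rule borel_measurable_continuous_onI)
  have "linear (\<lambda>V::real^'r^'d. V *v x)"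
    by (rule linearI) (simp_all add: matrix_vector_mult_add_rdistrib scaleR_matrix_vector_assoc)
  then show "continuous_on UNIV (\<lambda>V::real^'r^'d. V *v x)"
    by (simp add: linear_linear linear_continuous_on)
qed

lemma matrix_mult_right_borel_measurable:
  fixes Q :: "real^'e^'d"
  shows "(\<lambda>V. Q ** V) \<in> borel_measurable (borel :: (real^'r^'e) measure)"
proof (rule borel_measurable_continuous_onI)
  have "linear (\<lambda>V::real^'r^'e. Q ** V)"
    by (rule linearI) (simp_all add: matrix_matrix_mult_def vec_eq_iff sum.distrib sum_distrib_left
        algebra_simps)
  then show "continuous_on UNIV (\<lambda>V::real^'r^'e. Q ** V)"
    by (simp add: linear_linear linear_continuous_on)
qed

lemma stiefel_orthogonal_mult:
  assumes "V \<in> stiefel" "orthogonal_matrix Q"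
  shows "Q ** V \<in> stiefel"
proof -
  have "transpose (Q ** V) ** (Q ** V) = transpose V ** (transpose Q ** Q) ** V"
    by (simp only: matrix_transpose_mul matrix_mul_assoc)
  also have "transpose Q ** Q = mat 1" using assms(2) by (simp add: orthogonal_matrix_def)
  finally show ?thesis using assms(1) by (simp add: stiefel_def)
qed

lemma stiefel_norm_mult:
  assumes "V \<in> stiefel"
  shows "norm (V *v x) = norm x"
proof -
  have "(V *v x) \<bullet> (V *v x) = x \<bullet> (transpose V *v (V *v x))"
    by (metis dot_lmul_matrix inner_commute transpose_matrix_vector)
  also have "transpose V *v (V *v x) = (transpose V ** V) *v x" by (rule matrix_vector_mul_assoc)
  also have "\<dots> = x" using assms by (simp add: stiefel_def)
  finally show ?thesis by (simp add: norm_eq_sqrt_inner)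
qed

text \<open>With \<open>Q\<close> the matrix of \<open>T\<close>, associativity gives
  \<open>T (V *v x) = (Q ** V) *v x\<close>, so invariance passes from the Stiefel manifold to its
  image under evaluation at \<open>x\<close>.\<close>

lemma uniform_stiefel_mult_vector_invariant:
  fixes U :: "'a \<Rightarrow> real^'r^'d"
  assumes U[measurable]: "U \<in> measurable M stiefel_borel"
    and unif: "uniform_on_stiefel (distr M stiefel_borel U)"
    and T: "orthogonal_transformation T"
  shows "distr (distr M borel (\<lambda>\<omega>. U \<omega> *v x)) borel T = distr M borel (\<lambda>\<omega>. U \<omega> *v x)"
proof -
  define Q where "Q = matrix T"
  have Q: "orthogonal_matrix Q" "T = (*v) Q"
    using T unfolding orthogonal_transformation_matrix by (auto simp: Q_def matrix_works fun_eq_iff)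
  note [measurable] = orthogonal_transformation_borel_measurable[OF T]
  have ev[measurable]: "(\<lambda>V. V *v x) \<in> measurable stiefel_borel borel"
    by (rule measurable_restrict_space1[OF matrix_vector_mult_left_borel_measurable])
  have [measurable]: "(\<lambda>V. Q ** V) \<in> measurable stiefel_borel (stiefel_borel :: (real^'r^'d) measure)"
    by (rule measurable_restrict_space3[OF matrix_mult_right_borel_measurable])
      (auto intro: stiefel_orthogonal_mult[OF _ Q(1)])
  let ?\<mu> = "distr M stiefel_borel U"
  have inv: "distr ?\<mu> stiefel_borel (\<lambda>V. Q ** V) = ?\<mu>"
    using unif Q(1) by (simp add: uniform_on_stiefel_def)
  have push: "distr M borel (\<lambda>\<omega>. U \<omega> *v x) = distr ?\<mu> borel (\<lambda>V. V *v x)"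
    by (subst distr_distr) (auto simp: comp_def)
  have "distr (distr ?\<mu> borel (\<lambda>V. V *v x)) borel T = distr ?\<mu> borel (\<lambda>V. T (V *v x))"
    by (subst distr_distr) (auto simp: comp_def)
  also have "(\<lambda>V. T (V *v x)) = (\<lambda>V. (Q ** V) *v x)"
    by (simp add: Q(2) matrix_vector_mul_assoc)
  also have "distr ?\<mu> borel (\<lambda>V. (Q ** V) *v x) = distr (distr ?\<mu> stiefel_borel (\<lambda>V. Q ** V)) borel (\<lambda>V. V *v x)"
    by (subst distr_distr) (auto simp: comp_def)
  also have "\<dots> = distr ?\<mu> borel (\<lambda>V. V *v x)" unfolding inv ..
  finally show ?thesis unfolding push .
qed

text \<open>The two-sided bound comes from the one-sided bound for \<open>A\<close> and for
  \<open>- A\<close>, which have the same norms; this costs the factor 2.\<close>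

lemma stiefel_quadratic_tail:
  fixes A :: "real^'d^'d" and U :: "'a \<Rightarrow> real^'r^'d"
  defines "d \<equiv> real CARD('d)"
  assumes M: "prob_space M" and U[measurable]: "U \<in> measurable M stiefel_borel"
    and unif: "uniform_on_stiefel (distr M stiefel_borel U)" and x: "norm x = 1"
    and A: "transpose A = A" and a: "0 \<le> a" and \<theta>: "0 \<le> \<theta>"
    and large: "2 * a * (norm A + sqrt d * \<theta>) + 4 * a\<^sup>2 * onorm ((*v) A) \<le> d * \<theta>"
  shows "measure M {\<omega> \<in> space M. \<bar>(U \<omega> *v x) \<bullet> (A *v (U \<omega> *v x)) - trace A / d\<bar> > \<theta>} \<le> 2 * exp (- a\<^sup>2)"
    and "{\<omega> \<in> space M. \<bar>(U \<omega> *v x) \<bullet> (A *v (U \<omega> *v x)) - trace A / d\<bar> > \<theta>} \<in> sets M"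
proof -
  interpret M: prob_space M by (rule M)
  have [measurable]: "(\<lambda>V. V *v x) \<in> measurable stiefel_borel (borel :: (real^'d) measure)"
    by (rule measurable_restrict_space1[OF matrix_vector_mult_left_borel_measurable])
  have Ux[measurable]: "(\<lambda>\<omega>. U \<omega> *v x) \<in> borel_measurable M"
    by measurable
  have [measurable]: "(*v) B \<in> borel_measurable borel" for B :: "real^'d^'d"
    by (intro borel_measurable_continuous_onI linear_continuous_on) simp
  let ?q = "\<lambda>B::real^'d^'d. \<lambda>\<omega>. (U \<omega> *v x) \<bullet> (B *v (U \<omega> *v x)) - trace B / d"
  let ?E = "\<lambda>B. {\<omega> \<in> space M. ?q B \<omega> > \<theta>}"
  have one_sided: "M.prob (?E B) \<le> exp (- a\<^sup>2)"
    if "transpose B = B" "norm B = norm A" "onorm ((*v) B) = onorm ((*v) A)" for B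
  proof -
    let ?\<mu> = "distr M borel (\<lambda>\<omega>. U \<omega> *v x)"
    have "M.prob (?E B) = measure ?\<mu> {y. y \<bullet> (B *v y) - trace B / d > \<theta>}"
      by (subst measure_distr) (auto intro!: arg_cong[where f="M.prob"])
    also have "\<dots> \<le> exp (- a\<^sup>2)"
      unfolding d_def
    proof (rule sphere_quadratic_tail)
      show "prob_space ?\<mu>" by (rule M.prob_space_distr) measurable
      have "U \<omega> \<in> stiefel" if "\<omega> \<in> space M" for \<omega>
        using measurable_space[OF U that] by (simp add: space_restrict_space)
      then show "AE y in ?\<mu>. norm y = 1"
        by (subst AE_distr_iff) (auto simp: stiefel_norm_mult x)
      show "distr ?\<mu> borel T = ?\<mu>" if "orthogonal_transformation T" for T
        by (rule uniform_stiefel_mult_vector_invariant[OF U unif that])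
    qed (use that a \<theta> large in \<open>auto simp: d_def\<close>)
    finally show ?thesis .
  qed
  have neg: "(- A) *v y = - (A *v y)" for y
    by (simp add: vec_eq_iff matrix_vector_mult_def sum_negf)
  have neg': "transpose (- A) = - A" "trace (- A) = - trace A"
    using A by (simp_all add: transpose_def vec_eq_iff trace_def sum_negf)
  have split: "{\<omega> \<in> space M. \<bar>?q A \<omega>\<bar> > \<theta>} = ?E A \<union> ?E (- A)"
    by (auto simp: neg neg')
  show "{\<omega> \<in> space M. \<bar>?q A \<omega>\<bar> > \<theta>} \<in> sets M" by measurable
  have "M.prob (?E A \<union> ?E (- A)) \<le> M.prob (?E A) + M.prob (?E (- A))"
    by (rule measure_Un_le) measurable
  also have "\<dots> \<le> exp (- a\<^sup>2) + exp (- a\<^sup>2)"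
  proof (intro add_mono one_sided)
    show "onorm ((*v) (- A)) = onorm ((*v) A)" unfolding neg by (rule onorm_neg)
  qed (use A neg' in auto)
  finally show "M.prob {\<omega> \<in> space M. \<bar>?q A \<omega>\<bar> > \<theta>} \<le> 2 * exp (- a\<^sup>2)"
    unfolding split by simp
qed

section \<open>Union bound over the net\<close>

theorem proposition6p4:
  fixes A :: "real^'d^'d"
    and M :: "'a measure"
    and U :: "'a \<Rightarrow> real^'r^'d"
    and t :: real
  assumes "transpose A = A"
    and "prob_space M"
    and "U \<in> measurable M stiefel_borel"
    and "uniform_on_stiefel (distr M stiefel_borel U)"
    and "0 \<le> t" and "t \<le> real CARD('d) / 4"
  shows "measure M {\<omega> \<in> space M.
           ereal (op_norm (transpose (U \<omega>) ** A ** U \<omega> - (trace A / real CARD('d)) *\<^sub>R mat 1))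
             > deviation_threshold A t}
         \<le> 3 * exp (- t + 2.2 * real CARD('r))"
proof (cases "t = real CARD('d) / 4")
  \<comment> \<open>The threshold is infinite, so the event is empty.\<close>
  case True
  then show ?thesis by (simp add: deviation_threshold_def)
next
  case False
  interpret M: prob_space M by fact
  define d where "d = real CARD('d)"
  have d: "d > 0" by (simp add: d_def)
  have t: "0 \<le> t" "t < d / 4" using assms False by (auto simp: d_def)
  define a where "a = sqrt t"
  have a: "0 \<le> a" "a\<^sup>2 = t" using t by (auto simp: a_def)
  have denom: "d * (1 - 2 * sqrt (t / d)) = d - 2 * a * sqrt d"
    using d real_div_sqrt[of d] by (simp add: a_def real_sqrt_divide algebra_simps)
      (metis mult.commute real_sqrt_mult_self times_divide_eq_left)
  have "sqrt t < sqrt (d / 4)" using t by simp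
  then have "2 * a < sqrt d" by (simp add: a_def real_sqrt_divide)
  then have "2 * a * sqrt d < sqrt d * sqrt d" using d by (intro mult_strict_right_mono) auto
  then have D: "d - 2 * a * sqrt d > 0" using d by simp
  define K where "K = onorm ((*v) A)"
  have K: "K \<ge> 0" unfolding K_def by (intro onorm_pos_le) simp
  \<comment> \<open>Half of the stated threshold, since passing from the net to the operator norm
    loses a factor 2.\<close>
  define \<theta> where "\<theta> = 4 * (a * norm A + t * K) / (d - 2 * a * sqrt d)"
  have \<theta>: "\<theta> \<ge> 0" unfolding \<theta>_def using a t K D by simp
  have large: "2 * a * (norm A + sqrt d * \<theta>) + 4 * a\<^sup>2 * onorm ((*v) A) \<le> d * \<theta>"
  proof -
    \<comment> \<open>After moving the \<open>\<theta>\<close> terms to one side, only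
      \<open>2 * a * norm A + 4 * t * K\<close> is required here. The bound \<open>D\<close> keeps
      the denominator positive.\<close>
    have "\<theta> * (d - 2 * a * sqrt d) = 4 * (a * norm A + t * K)" using D by (simp add: \<theta>_def)
    moreover have "0 \<le> a * norm A" using a by simp
    ultimately show ?thesis by (simp add: a(2) algebra_simps flip: K_def)
  qed
  have threshold: "deviation_threshold A t = ereal (2 * \<theta>)"
    using False denom
    by (simp add: deviation_threshold_def \<theta>_def frobenius_norm_eq_norm a_def K_def flip: d_def)
  obtain N :: "(real^'r) set" where N: "finite N" "N \<subseteq> sphere 0 1" "card N \<le> 9 ^ DIM(real^'r)"
    and net: "\<And>y. norm y = 1 \<Longrightarrow> \<exists>x\<in>N. dist x y < 1/4"
    using unit_sphere_net by blast
  define E where "E x = {\<omega> \<in> space M. \<bar>(U \<omega> *v x) \<bullet> (A *v (U \<omega> *v x)) - trace A / d\<bar> > \<theta>}" for x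
  have E: "M.prob (E x) \<le> 2 * exp (- t)" "E x \<in> sets M" if "x \<in> N" for x
    using stiefel_quadratic_tail[OF assms(2-4) _ assms(1) a(1) \<theta>, of x] large that N(2)
    by (auto simp: E_def d_def a(2))
  have "{\<omega> \<in> space M.
           ereal (op_norm (transpose (U \<omega>) ** A ** U \<omega> - (trace A / d) *\<^sub>R mat 1))
             > deviation_threshold A t} \<subseteq> (\<Union>x\<in>N. E x)"
  proof
    fix \<omega> assume "\<omega> \<in> {\<omega> \<in> space M.
           ereal (op_norm (transpose (U \<omega>) ** A ** U \<omega> - (trace A / d) *\<^sub>R mat 1))
             > deviation_threshold A t}"
    then have \<omega>: "\<omega> \<in> space M"
      and big: "op_norm (transpose (U \<omega>) ** A ** U \<omega> - (trace A / d) *\<^sub>R mat 1) > 2 * \<theta>"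
      by (auto simp: threshold)
    let ?X = "transpose (U \<omega>) ** A ** U \<omega> - (trace A / d) *\<^sub>R mat 1"
    have sym: "transpose ?X = ?X"
    proof -
      have "transpose (transpose (U \<omega>) ** A ** U \<omega>) = transpose (U \<omega>) ** A ** U \<omega>"
        by (simp add: matrix_transpose_mul assms(1) matrix_mul_assoc)
      moreover have "transpose (P - k *\<^sub>R mat 1) = transpose P - k *\<^sub>R mat 1" for P :: "real^'r^'r" and k
        by (auto simp: transpose_def vec_eq_iff mat_def)
      ultimately show ?thesis by simp
    qed
    have form: "x \<bullet> (?X *v x) = (U \<omega> *v x) \<bullet> (A *v (U \<omega> *v x)) - trace A / d" if "x \<in> N" for x
    proof -
      have "x \<bullet> x = 1" using that N(2) by (auto simp: norm_eq_1)
      moreover have "x \<bullet> (transpose (U \<omega>) *v (A *v (U \<omega> *v x))) = (U \<omega> *v x) \<bullet> (A *v (U \<omega> *v x))"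
        by (metis dot_lmul_matrix inner_commute transpose_matrix_vector)
      moreover have "?X *v x = transpose (U \<omega>) *v (A *v (U \<omega> *v x)) - (trace A / d) *\<^sub>R x"
        by (simp only: matrix_vector_mult_diff_rdistrib matrix_vector_mul_assoc matrix_mul_assoc
            scaleR_matrix_vector_assoc[symmetric] matrix_vector_mul_lid)
      ultimately show ?thesis by (simp add: inner_diff_right)
    qed
    have "\<exists>x\<in>N. \<theta> < \<bar>x \<bullet> (?X *v x)\<bar>"
    proof (rule ccontr)
      assume "\<not> ?thesis"
      then have "op_norm ?X \<le> 2 * \<theta>"
        by (intro onorm_symmetric_le_net[OF sym N(2) net]) (auto simp: not_less)
      with big show False by simp
    qed
    then show "\<omega> \<in> (\<Union>x\<in>N. E x)" using \<omega> form by (auto simp: E_def)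
  qed
  then have "M.prob {\<omega> \<in> space M.
           ereal (op_norm (transpose (U \<omega>) ** A ** U \<omega> - (trace A / d) *\<^sub>R mat 1))
             > deviation_threshold A t} \<le> M.prob (\<Union>x\<in>N. E x)"
    using N(1) E(2) by (intro M.finite_measure_mono) auto
  also have "\<dots> \<le> (\<Sum>x\<in>N. M.prob (E x))"
    using N(1) E(2) by (intro M.finite_measure_subadditive_finite) auto
  also have "\<dots> \<le> (\<Sum>x\<in>N. 2 * exp (- t))" by (intro sum_mono E)
  also have "\<dots> = real (card N) * (2 * exp (- t))" by simp
  \<comment> \<open>The net has at most \<open>9 ^ CARD('r)\<close> points, and the two-sided factor
    2 is rounded up to 3.\<close>
  also have "\<dots> \<le> exp (2.2 * real CARD('r)) * (3 * exp (- t))"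
  proof (rule mult_mono)
    have "real (card N) \<le> 9 ^ CARD('r)"
      using N(3) by (metis DIM_cart DIM_real mult.right_neutral of_nat_le_iff of_nat_numeral of_nat_power)
    then show "real (card N) \<le> exp (2.2 * real CARD('r))"
      using nine_power_le_exp[of "CARD('r)"] by linarith
  qed auto
  also have "\<dots> = 3 * exp (- t + 2.2 * real CARD('r))" by (simp add: mult_exp_exp)
  finally show ?thesis unfolding d_def .
qed

end
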